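(* There exists a positive integer $k$ such that every integer $n \geq 2$ can be represented as the sum of $k$ odd primes.
   Formalization: "The sum of k odd primes" is read as "the sum of at most k odd primes" (exactly k fails by parity), and for n = 2 and n = 4, which are not sums of odd primes, the prime 2 is allowed. *)

theory Defs
  imports Complex_Main "HOL-Computational_Algebra.Primes" "HOL-Library.Multiset"
begin

text \<open>
  Read word for word, "some k > 0 is such that every n \<ge> 2 is a sum of k odd primes" is false:
  a sum of k odd primes has the parity of k, so no fixed k serves all n. This is the first
  lemma below. Reading "k" as "at most k" (as in Schnirelmann's theorem) removes the parity
  obstruction, but 2 and 4 are still not sums of odd primes, whatever the number of
  summands; this is the second lemma. Representations are multisets of primes, so
  repetitions are allowed.
\<close>

lemma no_fixed_number_of_odd_primes:
  "\<not> (\<exists>k::nat. k > 0 \<and> (\<forall>n::nat. n \<ge> 2 \<longrightarrow>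
        (\<exists>M. size M = k \<and> (\<forall>p\<in>#M. prime p \<and> odd p) \<and> sum_mset M = n)))"
proof -
  have par: "even (sum_mset M) \<longleftrightarrow> even (size M)" if "\<forall>p\<in>#M. prime p \<and> odd p" for M :: "nat multiset"
    using that by (induction M) auto
  have "\<exists>n::nat. n \<ge> 2 \<and> (even n \<longleftrightarrow> odd k)" for k :: nat
    by (rule exI[of _ "k + 3"]) simp
  then show ?thesis
    by (metis par)
qed

lemma two_four_not_sum_of_odd_primes:
  fixes M :: "nat multiset"
  assumes "\<forall>p\<in>#M. prime p \<and> odd p"
  shows "sum_mset M \<noteq> 2" and "sum_mset M \<noteq> 4"
proof -
  have par: "even (sum_mset M) \<longleftrightarrow> even (size M)"
    using assms by (induction M) auto
  have ge: "3 * size M \<le> sum_mset M"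
    using assms
  proof (induction M)
    case (add p M)
    then have "prime p" "odd p" by auto
    then have "p \<ge> 3"
      using prime_ge_2_nat[of p] by (cases "p = 2") auto
    with add show ?case by auto
  qed simp
  have "size M = 0 \<or> size M = 1 \<or> size M \<ge> 2" by linarith
  then show "sum_mset M \<noteq> 2" and "sum_mset M \<noteq> 4"
    using par ge by auto
qed

end

(* Schnirelmann's argument. If A has counting function at least delta * n for all n >= 1, then the
   gap inequality C(n) >= A(n) + beta * (n - A(n)) for sumsets drives the density of repeated sums
   of A above 1/2, and two sets of density 1/2 containing 0 sum to everything. This is applied to
   1 together with all p + q, p and q odd primes; the ones left over, plus a reserved 6, are then
   written as sums of 3, 5 and 7.

   The density of the p + q comes from Cauchy-Schwarz: (sum r)^2 <= #{p + q} * (sum r^2), where r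
   counts representations. Chebyshev's lower bound makes sum r large, and an upper bound
   r(n) << N / (log N)^2 * prod_{p | n} (1 - 1/p)^(-1) controls sum r^2. That bound is
   obtained from the Brun-Hooley sieve with the primes split into the blocks
   2^(2^i) < p <= 2^(2^(i+1)): inclusion-exclusion is truncated in each block separately, which
   needs from prime number theory only that the sum of 1/p over a block is bounded. All scales are
   powers of 2, so that log N is replaced by the exponent. *)

theory Submission
  imports Defs "HOL-Analysis.Convex" "HOL-Number_Theory.Cong"
begin

section \<open>Sums of a set of positive density\<close>

definition counting :: "nat set \<Rightarrow> nat \<Rightarrow> nat" where
  "counting X n = card (X \<inter> {1..n})"

text \<open>At most \<open>h\<close> summands instead of exactly \<open>h\<close>: the empty
  multiset puts 0 into every \<open>sums_le h A\<close>, and the gap inequality needs 0 in both of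
  its sets.\<close>

definition sums_le :: "nat \<Rightarrow> nat set \<Rightarrow> nat set" where
  "sums_le h A = {sum_mset M | M. set_mset M \<subseteq> A \<and> size M \<le> h}"

lemma counting_0 [simp]: "counting X 0 = 0"
  by (simp add: counting_def)

lemma counting_Suc: "counting X (Suc n) = counting X n + (if Suc n \<in> X then 1 else 0)"
proof -
  have "X \<inter> {1..Suc n} = (if Suc n \<in> X then insert (Suc n) (X \<inter> {1..n}) else X \<inter> {1..n})"
    by (auto simp: le_Suc_eq)
  then show ?thesis by (simp add: counting_def)
qed

lemma counting_le: "counting X n \<le> n"
  using card_mono[of "{1..n}" "X \<inter> {1..n}"] by (simp add: counting_def)

lemma counting_mono: "X \<subseteq> Y \<Longrightarrow> counting X n \<le> counting Y n"
  unfolding counting_def by (rule card_mono) auto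

text \<open>The part of \<open>C\<close> up to \<open>a\<close> and the translates
  \<open>a + b\<close> with \<open>1 \<le> b \<le> m\<close> lie in disjoint intervals.\<close>

lemma counting_shift:
  assumes "a \<in> A" "\<And>a b. a \<in> A \<Longrightarrow> b \<in> B \<Longrightarrow> a + b \<in> C"
  shows "counting C a + counting B m \<le> counting C (a + m)"
proof -
  have "card ((+) a ` (B \<inter> {1..m})) = counting B m"
    by (simp add: counting_def card_image)
  moreover have "card (C \<inter> {1..a} \<union> (+) a ` (B \<inter> {1..m})) = card (C \<inter> {1..a}) + card ((+) a ` (B \<inter> {1..m}))"
    by (rule card_Un_disjoint) auto
  moreover have "C \<inter> {1..a} \<union> (+) a ` (B \<inter> {1..m}) \<subseteq> C \<inter> {1..a + m}"
    using assms by auto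
  then have "card (C \<inter> {1..a} \<union> (+) a ` (B \<inter> {1..m})) \<le> counting C (a + m)"
    unfolding counting_def by (rule card_mono[rotated]) simp
  ultimately show ?thesis by (simp add: counting_def)
qed

text \<open>Schnirelmann's gap inequality, by strong induction. If \<open>n\<close> is in
  \<open>A\<close>, passing from \<open>n - 1\<close> to \<open>n\<close> raises both sides by 1.
  Otherwise let \<open>a\<close> be the last element of \<open>A\<close> below \<open>n\<close>: the
  sums \<open>a + b\<close> put at least \<open>\<beta> * (n - a)\<close> elements of
  \<open>C\<close> into the gap after \<open>a\<close>.\<close>

lemma counting_sumset_ge:
  fixes \<beta> :: real
  assumes "0 \<in> A" "0 \<in> B" and \<beta>: "\<And>n. \<beta> * n \<le> counting B n"
    and C: "\<And>a b. a \<in> A \<Longrightarrow> b \<in> B \<Longrightarrow> a + b \<in> C"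
  shows "counting A n + \<beta> * (real n - counting A n) \<le> counting C n"
proof (induction n rule: less_induct)
  case (less n)
  show ?case
  proof (cases "n = 0")
    case False
    show ?thesis
    proof (cases "n \<in> A")
      case True
      with C[of n 0] \<open>0 \<in> B\<close> have "n \<in> C" by simp
      obtain m where m: "n = Suc m" using False by (cases n) auto
      show ?thesis using less[of m] True \<open>n \<in> C\<close> by (simp add: m counting_Suc)
    next
      case nA: False
      define a where "a = Max (A \<inter> {..n})"
      have "a \<in> A \<inter> {..n}" unfolding a_def using \<open>0 \<in> A\<close> by (intro Max_in) auto
      then have a: "a \<in> A" "a < n" using nA by (auto simp: less_le)
      have "b \<le> a" if "b \<in> A" "b \<le> n" for b
        unfolding a_def using that by (intro Max_ge) auto
      then have "A \<inter> {1..n} = A \<inter> {1..a}" using a by fastforce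
      then have cA: "counting A n = counting A a" by (simp add: counting_def)
      have "counting C a + counting B (n - a) \<le> counting C n"
        using counting_shift[of a A B C "n - a"] a C by simp
      then have "real (counting C a) + counting B (n - a) \<le> counting C n"
        by linarith
      moreover have "\<beta> * (real n - a) \<le> counting B (n - a)" 
        using \<beta>[of "n - a"] a by (simp add: of_nat_diff)
      ultimately show ?thesis using less[OF a(2)] cA by (simp add: algebra_simps)
    qed
  qed simp
qed

lemma zero_in_sums_le: "0 \<in> sums_le h A"
  unfolding sums_le_def by (auto intro: exI[of _ "{#}"])

lemma sums_le_add:
  assumes "a \<in> sums_le h A" "b \<in> sums_le h' A"
  shows "a + b \<in> sums_le (h + h') A"
proof -
  obtain M N where "set_mset M \<subseteq> A" "size M \<le> h" "a = sum_mset M"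
    "set_mset N \<subseteq> A" "size N \<le> h'" "b = sum_mset N"
    using assms unfolding sums_le_def by auto
  then have "a + b = sum_mset (M + N) \<and> set_mset (M + N) \<subseteq> A \<and> size (M + N) \<le> h + h'" by auto
  then show ?thesis unfolding sums_le_def by blast
qed

lemma subset_sums_le: "A \<subseteq> sums_le 1 A"
proof
  fix a assume "a \<in> A"
  then have "a = sum_mset {#a#} \<and> set_mset {#a#} \<subseteq> A \<and> size {#a#} \<le> 1" by simp
  then show "a \<in> sums_le 1 A" unfolding sums_le_def by blast
qed

text \<open>By the gap inequality with \<open>\<beta> = \<delta>\<close>, one more summand
  multiplies the deficit \<open>1 - density\<close> by \<open>1 - \<delta>\<close>.\<close>

lemma counting_sums_le:
  fixes \<delta> :: real
  assumes \<delta>: "\<And>n. \<delta> * n \<le> counting A n" and "\<delta> \<le> 1"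
  shows "(1 - (1 - \<delta>) ^ h) * n \<le> counting (sums_le h A) n"
proof (induction h arbitrary: n)
  case (Suc h)
  let ?B = "sums_le h A" and ?A = "sums_le 1 A"
  have A: "\<delta> * n \<le> counting ?A n"
    using \<delta>[of n] counting_mono[OF subset_sums_le, of A n] by linarith
  have "counting ?B n + \<delta> * (real n - counting ?B n) \<le> counting (sums_le (Suc h) A) n"
  proof (rule counting_sumset_ge)
    show "\<delta> * n \<le> counting ?A n" for n
      using \<delta>[of n] counting_mono[OF subset_sums_le, of A n] by linarith
    show "a + b \<in> sums_le (Suc h) A" if "a \<in> ?B" "b \<in> ?A" for a b
      using sums_le_add[OF that] by simp
  qed (rule zero_in_sums_le)+
  moreover have "(1 - \<delta>) * ((1 - (1 - \<delta>) ^ h) * n) \<le> (1 - \<delta>) * counting ?B n"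
    using Suc.IH[of n] \<open>\<delta> \<le> 1\<close> by (intro mult_left_mono) auto
  ultimately show ?case by (simp add: algebra_simps)
qed simp

text \<open>Pigeonhole: \<open>B\<close> within \<open>0..n\<close> and its reflection under
  \<open>b \<mapsto> n - b\<close> each have \<open>counting B n + 1\<close> elements, in total at
  least \<open>n + 2\<close>, while there are only \<open>n + 1\<close> places. A common point gives
  the two summands.\<close>

lemma add_of_counting:
  assumes "0 \<in> B" "n \<le> 2 * counting B n"
  obtains a b where "a \<in> B" "b \<in> B" "a + b = n"
proof -
  let ?B = "B \<inter> {0..n}"
  have "?B = insert 0 (B \<inter> {1..n})" using \<open>0 \<in> B\<close> by force
  then have cB: "card ?B = Suc (counting B n)" by (simp add: counting_def)
  have "inj_on (\<lambda>b. n - b) ?B" by (rule inj_onI) auto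
  then have cB': "card ((\<lambda>b. n - b) ` ?B) = Suc (counting B n)" by (simp add: card_image cB)
  have "?B \<inter> (\<lambda>b. n - b) ` ?B \<noteq> {}"
  proof
    assume "?B \<inter> (\<lambda>b. n - b) ` ?B = {}"
    then have "card (?B \<union> (\<lambda>b. n - b) ` ?B) = card ?B + card ((\<lambda>b. n - b) ` ?B)"
      by (intro card_Un_disjoint) auto
    moreover have "card (?B \<union> (\<lambda>b. n - b) ` ?B) \<le> card {0..n}" by (intro card_mono) auto
    ultimately show False using assms(2) cB cB' by simp
  qed
  then obtain b where "b \<in> B" "b \<le> n" "n - b \<in> B" by auto
  then show thesis by (intro that[of "n - b" b]) auto
qed

theorem schnirelmann_basis:
  fixes \<delta> :: real
  assumes "\<delta> > 0" and \<delta>: "\<And>n. \<delta> * n \<le> counting A n"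
  obtains h where "sums_le h A = UNIV"
proof -
  \<comment> \<open>The hypothesis at \<open>n = 1\<close> bounds \<open>\<delta>\<close>; then
    \<open>h\<close> is taken so large that \<open>h\<close> summands have density above 1/2, and
    twice as many reach every number.\<close>
  have "\<delta> \<le> 1" using \<delta>[of 1] counting_le[of A 1] by simp
  then obtain h where h: "(1 - \<delta>) ^ h < 1 / 2"
    using real_arch_pow_inv[of "1/2" "1 - \<delta>"] \<open>\<delta> > 0\<close> by auto
  have "n \<in> sums_le (h + h) A" for n
  proof -
    have "1 / 2 * n \<le> (1 - (1 - \<delta>) ^ h) * n" using h by (intro mult_right_mono) auto
    also have "\<dots> \<le> counting (sums_le h A) n" by (rule counting_sums_le[OF \<delta> \<open>\<delta> \<le> 1\<close>])
    finally have "n \<le> 2 * counting (sums_le h A) n" by linarith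
    from add_of_counting[OF zero_in_sums_le this] show ?thesis using sums_le_add by metis
  qed
  then show thesis by (intro that[of "h + h"]) auto
qed

section \<open>Chebyshev and Mertens bounds\<close>

text \<open>The induction is the recurrence of the Leibniz harmonic triangle:
  \<open>1/((k+1) C(n,k+1)) = 1/(k C(n-1,k)) - 1/(k C(n,k))\<close>.\<close>

lemma choose_times_index_dvd:
  fixes L :: nat
  assumes "\<And>j. 1 \<le> j \<Longrightarrow> j \<le> N \<Longrightarrow> j dvd L" and "1 \<le> k" "k \<le> n" "n \<le> N"
  shows "k * (n choose k) dvd L"
proof -
  have "real L / (k * (n choose k)) \<in> \<int>" using assms(2,3,4)
  proof (induction k arbitrary: n rule: dec_induct)
    case base
    then have "n dvd L" using assms(1)[of n] by simp
    then show ?case using base by (auto elim!: dvdE)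
  next
    case (step k)
    then obtain m where m: "n = Suc m" "k \<le> m" by (cases n) auto
    let ?c = "real (m choose k)"
    have c: "?c > 0" using m by (simp add: zero_less_binomial)
    have "Suc k * (n choose Suc k) = n * (m choose k)"
      using Suc_times_binomial[of k m] m by simp
    then have 1: "real (Suc k) * (n choose Suc k) = n * ?c"
      by (metis of_nat_mult)
    have "(n - k) * (n choose k) = n * (m choose k)"
      using binomial_absorb_comp[of n k] m by simp
    then have 2: "(real n - k) * real (n choose k) = n * ?c"
      using m by (metis le_SucI of_nat_diff of_nat_mult)
    have nk: "real n - k > 0" using m by simp
    have "real L / (real (Suc k) * (n choose Suc k)) = real L / (k * ?c) - real L / (k * (n choose k))"
    proof -
      have "real (n choose k) = n * ?c / (real n - k)" using 2 nk by (simp add: field_simps)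
      then show ?thesis unfolding 1 using nk c step.hyps m
        by (simp add: divide_simps) (simp add: algebra_simps)
    qed
    moreover have "real L / (k * ?c) \<in> \<int>" "real L / (k * (n choose k)) \<in> \<int>"
      using step.IH[of m] step.IH[of n] step.prems m by auto
    ultimately show ?case by (metis Ints_diff of_nat_mult)
  qed
  then obtain z :: int where "real L / (k * (n choose k)) = of_int z" by (auto elim: Ints_cases)
  moreover have "k * (n choose k) > 0" using assms by (simp add: zero_less_binomial)
  ultimately have "real L = of_int (z * int (k * (n choose k)))" by (simp add: field_simps)
  then have "int L = z * int (k * (n choose k))" by (metis of_int_eq_iff of_int_of_nat_eq)
  then show ?thesis by (metis dvd_triv_right int_dvd_int_iff)
qed

lemma finite_primes_le [simp]: "finite {p::nat. prime p \<and> p \<le> n}"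
  by (rule finite_subset[of _ "{..n}"]) auto

text \<open>\<open>L\<close> is the least common multiple of \<open>1..n\<close>: the product over
  the primes up to \<open>n\<close> of the largest power not exceeding \<open>n\<close>, so each
  prime contributes a factor of at most \<open>n\<close>.\<close>

lemma common_multiple_le_power_prime_count:
  assumes "n \<ge> 1"
  obtains L :: nat where "\<And>j. 1 \<le> j \<Longrightarrow> j \<le> n \<Longrightarrow> j dvd L"
    "0 < L" "L \<le> n ^ card {p::nat. prime p \<and> p \<le> n}"
proof -
  let ?P = "{p::nat. prime p \<and> p \<le> n}"
  have "\<exists>e. p ^ e \<le> n \<and> n < p ^ (e + 1)" if "p \<in> ?P" for p
    using ex_power_ivl1[of p n] that assms prime_ge_2_nat by auto
  then obtain e where e: "\<And>p. p \<in> ?P \<Longrightarrow> p ^ e p \<le> n \<and> n < p ^ (e p + 1)" by metis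
  define L where "L = (\<Prod>p\<in>?P. p ^ e p)"
  have L0: "L > 0" unfolding L_def by (intro prod_pos) (auto simp: prime_gt_0_nat)
  show thesis
  proof (rule that)
    show "0 < L" by fact
    have "L \<le> (\<Prod>p\<in>?P. n)" unfolding L_def using e by (intro prod_mono) auto
    then show "L \<le> n ^ card ?P" by simp
  next
    fix j :: nat assume j: "1 \<le> j" "j \<le> n"
    show "j dvd L"
    proof (rule multiplicity_le_imp_dvd)
      show "j \<noteq> 0" using j by simp
      fix p :: nat assume p: "prime p"
      show "multiplicity p j \<le> multiplicity p L"
      proof (cases "p \<in> ?P")
        case True
        have "p ^ multiplicity p j \<le> j" using j by (intro dvd_imp_le multiplicity_dvd) auto
        then have "p ^ multiplicity p j < p ^ (e p + 1)" using e[OF True] j by linarith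
        then have "multiplicity p j < e p + 1" 
          using p prime_gt_1_nat power_less_imp_less_exp by blast
        moreover have "p ^ e p dvd L" unfolding L_def using True by (intro dvd_prodI) auto
        then have "e p \<le> multiplicity p L" using p L0 
          by (intro multiplicity_geI) (auto simp: prime_gt_1_nat)
        ultimately show ?thesis by simp
      next
        case False
        then have "\<not> p dvd j" using p j dvd_imp_le[of p j] by auto
        then show ?thesis by (simp add: not_dvd_imp_multiplicity_0)
      qed
    qed
  qed
qed

text \<open>Nair's form of Chebyshev's bound. For \<open>2 * m = 2 ^ k\<close> the number
  \<open>m * ((2 * m) choose m)\<close> divides the common multiple \<open>L\<close> and is at least
  \<open>4 ^ m / 2\<close>. Comparing exponents of 2 gives the claim; the lost factor 2 is the
  \<open>+ 1\<close>.\<close>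

lemma prime_count_lower:
  assumes "k \<ge> 1"
  shows "2 ^ k \<le> k * card {p::nat. prime p \<and> p \<le> 2 ^ k} + 1"
proof -
  define m :: nat where "m = 2 ^ (k - 1)"
  have m: "2 * m = 2 ^ k" "m \<ge> 1" using assms by (auto simp: m_def simp flip: power_Suc)
  let ?\<pi> = "card {p::nat. prime p \<and> p \<le> 2 ^ k}"
  obtain L :: nat where L: "\<And>j. 1 \<le> j \<Longrightarrow> j \<le> 2 ^ k \<Longrightarrow> j dvd L"
    "0 < L" "L \<le> (2 ^ k) ^ ?\<pi>"
    using common_multiple_le_power_prime_count[of "2 ^ k"] by auto
  have "m * ((2 * m) choose m) dvd L"
    using choose_times_index_dvd[of "2 ^ k" L m "2 * m"] L m by auto
  then have "m * ((2 * m) choose m) \<le> (2 ^ k) ^ ?\<pi>" using L by (meson dvd_imp_le order_trans)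
  then have "real (m * ((2 * m) choose m)) \<le> real ((2 ^ k) ^ ?\<pi>)" by (rule of_nat_mono)
  moreover have "4 ^ m \<le> 2 * real (m * ((2 * m) choose m))"
    using central_binomial_lower_bound[of m] m by (simp add: field_simps)
  moreover have "(4::real) ^ m = 2 ^ (2 ^ k)" by (simp add: power_mult flip: m(1))
  ultimately have "(2::real) ^ (2 ^ k) \<le> 2 ^ (k * ?\<pi> + 1)" by (simp add: power_mult)
  then show ?thesis by (meson one_less_numeral_iff power_le_imp_le_exp semiring_norm(76))
qed

lemma prod_primes_dvd:
  fixes n :: nat
  assumes "finite D" "\<And>p. p \<in> D \<Longrightarrow> prime p \<and> p dvd n"
  shows "\<Prod>D dvd n"
  using assms
proof (induction D rule: finite_induct)
  case (insert p D)
  have "coprime p (\<Prod>D)"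
    using insert by (intro prod_coprime_right) (metis insertCI primes_coprime)
  then show ?case using insert by (simp add: divides_mult)
qed simp

text \<open>With \<open>m = 2 ^ k\<close>, every prime in the range divides
  \<open>(2 * m) choose m\<close>, which is at most \<open>4 ^ m\<close>, and every such prime
  exceeds \<open>2 ^ k\<close>.\<close>

lemma prime_count_dyadic_upper:
  "k * card {p::nat. prime p \<and> 2 ^ k < p \<and> p \<le> 2 ^ Suc k} \<le> 2 ^ Suc k"
proof -
  let ?P = "{p::nat. prime p \<and> 2 ^ k < p \<and> p \<le> 2 ^ Suc k}"
  have fin: "finite ?P" by (rule finite_subset[OF _ finite_primes_le[of "2 ^ Suc k"]]) auto
  define m :: nat where "m = 2 ^ k"
  have "p dvd (2 * m) choose m" if "p \<in> ?P" for p
  proof -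
    have "p dvd fact (2 * m)" "\<not> p dvd fact m"
      using that by (auto simp: m_def prime_dvd_fact_iff)
    moreover have "fact m * fact (2 * m - m) * ((2 * m) choose m) = (fact (2 * m) :: nat)"
      by (rule binomial_fact_lemma) simp
    ultimately show ?thesis using that
      by (metis (no_types, lifting) CollectD diff_add_inverse mult_2 prime_dvd_mult_iff)
  qed
  then have "\<Prod>?P dvd (2 * m) choose m" using fin by (intro prod_primes_dvd) auto
  then have "\<Prod>?P \<le> (2 * m) choose m" by (rule dvd_imp_le) (rule zero_less_binomial, simp)
  also have "\<dots> \<le> (\<Sum>i\<le>2 * m. (2 * m) choose i)" by (rule member_le_sum) auto
  also have "\<dots> = 2 ^ (2 ^ Suc k)" by (simp add: choose_row_sum m_def)
  finally have "\<Prod>?P \<le> 2 ^ (2 ^ Suc k)" .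
  moreover have "(\<Prod>p\<in>?P. 2 ^ k) \<le> \<Prod>?P" by (intro prod_mono) auto
  then have "2 ^ (k * card ?P) \<le> \<Prod>?P" by (simp add: power_mult)
  ultimately have "(2::nat) ^ (k * card ?P) \<le> 2 ^ (2 ^ Suc k)" by (rule order_trans[rotated])
  then show ?thesis by (meson one_less_numeral_iff power_le_imp_le_exp semiring_norm(76))
qed

text \<open>The primes between \<open>2 ^ (a + i)\<close> and \<open>2 ^ (a + i + 1)\<close>
  contribute at most \<open>2 / (a + i)\<close>, hence at most \<open>2 / a\<close>. For
  \<open>d = a\<close> the total is at most 2, uniformly in \<open>a\<close>, which is all that the
  sieve blocks require.\<close>

lemma sum_prime_reciprocals_dyadic:
  assumes "a \<ge> 1"
  shows "(\<Sum>p | prime (p::nat) \<and> 2 ^ a < p \<and> p \<le> 2 ^ (a + d). 1 / real p) \<le> d * (2 / a)"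
proof (induction d)
  case 0
  have "{p::nat. prime p \<and> 2 ^ a < p \<and> p \<le> 2 ^ (a + 0)} = {}" by auto
  then show ?case by (simp only:) simp
next
  case (Suc d)
  let ?A = "{p::nat. prime p \<and> 2 ^ a < p \<and> p \<le> 2 ^ (a + d)}"
  let ?B = "{p::nat. prime p \<and> 2 ^ (a + d) < p \<and> p \<le> 2 ^ Suc (a + d)}"
  have fin: "finite ?A" "finite ?B"
    by (rule finite_subset[OF _ finite_primes_le[of "2 ^ Suc (a + d)"]]; force)+
  have le: "(2::nat) ^ a \<le> 2 ^ (a + d)" by (intro power_increasing) auto
  have eq: "{p::nat. prime p \<and> 2 ^ a < p \<and> p \<le> 2 ^ (a + Suc d)} = ?A \<union> ?B"
    using le by (auto simp del: power_increasing_iff)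
  have "(\<Sum>p\<in>?B. 1 / real p) \<le> (\<Sum>p\<in>?B. 1 / 2 ^ (a + d))"
  proof (rule sum_mono)
    fix p assume "p \<in> ?B"
    then have "real (2 ^ (a + d)) \<le> real p" by (intro of_nat_mono) auto
    then show "1 / real p \<le> 1 / 2 ^ (a + d)" by (intro frac_le) auto
  qed
  also have "\<dots> = card ?B / 2 ^ (a + d)" by simp
  also have "\<dots> \<le> 2 / real (a + d)"
  proof -
    have "real ((a + d) * card ?B) \<le> real (2 ^ Suc (a + d))"
      by (rule of_nat_mono[OF prime_count_dyadic_upper])
    then show ?thesis using assms by (simp add: field_simps)
  qed
  also have "\<dots> \<le> 2 / a" using assms by (simp add: frac_le)
  finally have B: "(\<Sum>p\<in>?B. 1 / real p) \<le> 2 / a" .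
  have "(\<Sum>p\<in>?A \<union> ?B. 1 / real p) = (\<Sum>p\<in>?A. 1 / real p) + (\<Sum>p\<in>?B. 1 / real p)"
    using fin by (intro sum.union_disjoint) auto
  also have "\<dots> \<le> d * (2 / a) + 2 / a" using Suc B by linarith
  finally show ?case unfolding eq by (simp add: algebra_simps add_divide_distrib)
qed

section \<open>A lower bound for Mertens' product from the harmonic sum\<close>

lemma harmonic_dyadic_lower: "k / 2 \<le> (\<Sum>m\<in>{1..2 ^ k}. 1 / real m)"
proof (induction k)
  case (Suc k)
  have "{1..2 ^ Suc k} = {1..2 ^ k} \<union> {2 ^ k<..2 ^ Suc k::nat}" by auto
  then have "(\<Sum>m\<in>{1..2 ^ Suc k}. 1 / real m) =
      (\<Sum>m\<in>{1..2 ^ k}. 1 / real m) + (\<Sum>m\<in>{2 ^ k<..2 ^ Suc k}. 1 / real m)"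
    by (simp only:) (rule sum.union_disjoint; auto)
  moreover have "(\<Sum>m\<in>{2 ^ k<..2 ^ Suc k::nat}. 1 / 2 ^ Suc k) \<le> (\<Sum>m\<in>{2 ^ k<..2 ^ Suc k}. 1 / real m)"
  proof (intro sum_mono divide_left_mono)
    fix m :: nat assume m: "m \<in> {2 ^ k<..2 ^ Suc k}"
    then have "real m \<le> real (2 ^ Suc k)" by (intro of_nat_mono) auto
    then show "real m \<le> 2 ^ Suc k" by simp
    show "0 < 2 ^ Suc k * real m" using m by auto
  qed auto
  ultimately show ?case using Suc by (simp add: field_simps)
qed simp

text \<open>A finite replacement for multiplying geometric series. A multiple of \<open>p\<close> in
  the new index set is \<open>p\<close> times a member of the same set, so the new sum
  \<open>F'\<close> and the old sum \<open>F\<close> satisfy \<open>F' \<le> F + F' / p\<close>;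
  solving for \<open>F'\<close> produces the Euler factor at \<open>p\<close>.\<close>

lemma sum_reciprocals_le_euler_product:
  fixes x :: nat
  assumes "finite P" "\<And>p. p \<in> P \<Longrightarrow> prime p"
  shows "(\<Sum>m | m \<in> {1..x} \<and> prime_factors m \<subseteq> P. 1 / real m) \<le> (\<Prod>p\<in>P. 1 / (1 - 1 / real p))"
  using assms
proof (induction P rule: finite_induct)
  case empty
  have "{m \<in> {1..x}. prime_factors m \<subseteq> {}} \<subseteq> {1}"
    by (auto simp: prime_factorization_empty_iff)
  then have "(\<Sum>m | m \<in> {1..x} \<and> prime_factors m \<subseteq> {}. 1 / real m) \<le> (\<Sum>m\<in>{1}. 1 / real m)"
    by (intro sum_mono2) auto
  then show ?case by simp
next
  case (insert p P)
  let ?S = "\<lambda>P. {m \<in> {1..x}. prime_factors m \<subseteq> P}"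
  have p: "prime p" "p > 1" using insert prime_gt_1_nat by blast+
  have sub: "?S (insert p P) \<subseteq> ?S P \<union> (*) p ` ?S (insert p P)"
  proof
    fix m assume m: "m \<in> ?S (insert p P)"
    show "m \<in> ?S P \<union> (*) p ` ?S (insert p P)"
    proof (cases "p dvd m")
      case True
      then obtain m' where m': "m = p * m'" by auto
      then have "m' \<le> x" "m' \<ge> 1" using m p le_trans[of m' "p * m'" x] by auto
      moreover have "prime_factors m' \<subseteq> prime_factors m"
        using m m' by (intro dvd_prime_factors) auto
      ultimately show ?thesis using m m' by auto
    qed (use m in \<open>auto simp: prime_factors_dvd\<close>)
  qed
  let ?F = "\<lambda>P. \<Sum>m\<in>?S P. 1 / real m"
  have "?F (insert p P) \<le> (\<Sum>m\<in>?S P \<union> (*) p ` ?S (insert p P). 1 / real m)"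
    by (rule sum_mono2[OF _ sub]) auto
  also have "\<dots> \<le> ?F P + (\<Sum>m\<in>(*) p ` ?S (insert p P). 1 / real m)"
    by (subst sum.union_inter[symmetric]) (auto intro!: sum_nonneg)
  also have "(\<Sum>m\<in>(*) p ` ?S (insert p P). 1 / real m) = (\<Sum>m\<in>?S (insert p P). 1 / real (p * m))"
    using p by (subst sum.reindex) (auto simp: inj_on_def)
  also have "\<dots> = 1 / p * ?F (insert p P)" by (simp add: sum_distrib_left)
  finally have "?F (insert p P) * (1 - 1 / p) \<le> ?F P" by (simp add: algebra_simps)
  also have "\<dots> \<le> (\<Prod>p\<in>P. 1 / (1 - 1 / real p))" using insert by auto
  finally have "?F (insert p P) \<le> (\<Prod>p\<in>P. 1 / (1 - 1 / real p)) / (1 - 1 / p)"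
    using p by (simp add: field_simps)
  then show ?case using insert by simp
qed

text \<open>All \<open>m\<close> up to \<open>2 ^ k\<close> have only prime factors up to
  \<open>2 ^ k\<close>, so the Euler product dominates the whole harmonic sum.\<close>

lemma mertens_product_lower:
  "k / 2 \<le> (\<Prod>p | prime (p::nat) \<and> p \<le> 2 ^ k. 1 / (1 - 1 / real p))"
proof -
  let ?P = "{p::nat. prime p \<and> p \<le> 2 ^ k}"
  have "prime_factors m \<subseteq> ?P" if "m \<in> {1..2 ^ k}" for m
  proof
    fix p assume "p \<in> prime_factors m"
    then have "prime p" "p dvd m" by auto
    moreover have "p \<le> m" using \<open>p dvd m\<close> that by (intro dvd_imp_le) auto
    ultimately show "p \<in> ?P" using that by simp
  qed
  then have eq: "{m. m \<in> {1..2 ^ k} \<and> prime_factors m \<subseteq> ?P} = {1..2 ^ k}" by blast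
  have "(\<Sum>m | m \<in> {1..2 ^ k} \<and> prime_factors m \<subseteq> ?P. 1 / real m) \<le> (\<Prod>p\<in>?P. 1 / (1 - 1 / real p))"
    by (rule sum_reciprocals_le_euler_product) (rule finite_primes_le, blast)
  with harmonic_dyadic_lower[of k] show ?thesis unfolding eq by (rule order_trans)
qed

section \<open>The Brun--Hooley sieve\<close>

lemma card_residue_class:
  assumes "c < q"
  shows "\<bar>real (card {m. m < N \<and> m mod q = c}) - real N / q\<bar> \<le> 1"
proof -
  let ?S = "{m. m < N \<and> m mod q = c}" and ?f = "\<lambda>t. c + q * t"
  have inj: "inj_on ?f A" for A using assms by (auto simp: inj_on_def)
  have "?f ` {..<N div q} \<subseteq> ?S"
  proof clarsimp
    fix t assume "t < N div q"
    then have "q * Suc t \<le> q * (N div q)" by (intro mult_le_mono2) simp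
    also have "\<dots> \<le> N" by simp
    finally show "c + q * t < N \<and> c mod q = c" using assms by simp
  qed
  then have "card (?f ` {..<N div q}) \<le> card ?S" by (intro card_mono) auto
  then have 1: "N div q \<le> card ?S" by (simp add: card_image inj)
  have "?S \<subseteq> ?f ` {..N div q}"
  proof
    fix m assume m: "m \<in> ?S"
    then have "m = ?f (m div q)" by (metis (lifting) CollectD add.commute mult_div_mod_eq)
    moreover have "m div q \<le> N div q" using m by (intro div_le_mono) auto
    ultimately show "m \<in> ?f ` {..N div q}" by blast
  qed
  then have "card ?S \<le> card (?f ` {..N div q})" by (intro card_mono) auto
  then have 2: "card ?S \<le> N div q + 1" by (simp add: card_image inj)
  have "real (N div q) \<le> real N / q" "real N / q \<le> real (N div q) + 1"
  proof -
    have "N < q * (N div q + 1)" using assms by (simp add: dividend_less_times_div)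
    then have "real N < q * (real (N div q) + 1)" by (metis of_nat_1 of_nat_add of_nat_less_iff of_nat_mult)
    then show "real N / q \<le> real (N div q) + 1" using assms by (simp add: field_simps)
  qed (rule of_nat_div_le_of_nat)
  with 1 2 show ?thesis by linarith
qed

lemma card_crt_class:
  assumes "finite D" "\<And>p. p \<in> D \<Longrightarrow> prime (p::nat)" "\<And>p. p \<in> D \<Longrightarrow> c p < p"
  shows "\<bar>real (card {m. m < N \<and> (\<forall>p\<in>D. m mod p = c p)}) - real N / real (\<Prod>D)\<bar> \<le> 1"
proof -
  have cop: "\<forall>p\<in>D. \<forall>q\<in>D. p \<noteq> q \<longrightarrow> coprime p q" using assms primes_coprime by blast
  have "\<forall>p\<in>D. p \<noteq> 0" using assms(3) by fastforce
  from chinese_remainder_unique_nat[OF assms(1) this cop, of c]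
  obtain x where x: "x < \<Prod>D" "\<forall>p\<in>D. [x = c p] (mod p)" by auto
  have "(\<forall>p\<in>D. m mod p = c p) \<longleftrightarrow> m mod \<Prod>D = x" for m
  proof
    assume m: "\<forall>p\<in>D. m mod p = c p"
    have "[m = x] (mod \<Prod>D)"
      using coprime_cong_prod_nat[of D "\<lambda>p. p" m x] cop x m assms by (auto simp: cong_def)
    then show "m mod \<Prod>D = x" using x by (simp add: cong_def)
  next
    assume m: "m mod \<Prod>D = x"
    show "\<forall>p\<in>D. m mod p = c p"
    proof
      fix p assume "p \<in> D"
      then have "p dvd \<Prod>D" using assms(1) dvd_prodI[of D p "\<lambda>p. p"] by simp
      then have "m mod p = x mod p" using m by (metis mod_mod_cancel)
      then show "m mod p = c p" using x \<open>p \<in> D\<close> assms(3) by (simp add: cong_def)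
    qed
  qed
  then show ?thesis using card_residue_class[OF x(1), of N] by simp
qed

text \<open>The set splits according to the tuple of residues. Each tuple is a single class modulo
  \<open>\<Prod>D\<close> by the Chinese remainder theorem and costs an error of at most 1, so the
  total error is the number of tuples.\<close>

lemma card_residue_conditions:
  fixes N :: nat
  assumes D: "finite D" "\<And>p. p \<in> D \<Longrightarrow> prime (p::nat)" and R: "\<And>p. p \<in> D \<Longrightarrow> R p \<subseteq> {..<p}"
  shows "\<bar>real (card {m. m < N \<and> (\<forall>p\<in>D. m mod p \<in> R p)}) - N * (\<Prod>p\<in>D. card (R p) / real p)\<bar>
           \<le> (\<Prod>p\<in>D. real (card (R p)))"
proof -
  have finR: "\<And>p. p \<in> D \<Longrightarrow> finite (R p)" using R finite_subset by blast
  let ?C = "PiE D R" and ?S = "\<lambda>c. {m. m < N \<and> (\<forall>p\<in>D. m mod p = c p)}"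
  have finC: "finite ?C" using D finR by (intro finite_PiE) auto
  have "{m. m < N \<and> (\<forall>p\<in>D. m mod p \<in> R p)} = (\<Union>c\<in>?C. ?S c)"
  proof (intro equalityI subsetI)
    fix m assume m: "m \<in> {m. m < N \<and> (\<forall>p\<in>D. m mod p \<in> R p)}"
    then have "restrict (\<lambda>p. m mod p) D \<in> ?C" "m \<in> ?S (restrict (\<lambda>p. m mod p) D)" by auto
    then show "m \<in> (\<Union>c\<in>?C. ?S c)" by blast
  qed (auto simp: PiE_def)
  moreover have "card (\<Union>c\<in>?C. ?S c) = (\<Sum>c\<in>?C. card (?S c))"
  proof (rule card_UN_disjoint)
    have "c = c'" if "c \<in> ?C" "c' \<in> ?C" "m \<in> ?S c" "m \<in> ?S c'" for c c' m
      using that by (intro PiE_ext) auto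
    then show "\<forall>c\<in>?C. \<forall>c'\<in>?C. c \<noteq> c' \<longrightarrow> ?S c \<inter> ?S c' = {}" by blast
  qed (use finC in auto)
  ultimately have eq: "real (card {m. m < N \<and> (\<forall>p\<in>D. m mod p \<in> R p)}) = (\<Sum>c\<in>?C. real (card (?S c)))"
    by simp
  have "(\<Prod>p\<in>D. card (R p) / real p) = card ?C / real (\<Prod>D)"
    using D by (simp add: prod_dividef card_PiE)
  then have eq2: "N * (\<Prod>p\<in>D. card (R p) / real p) = (\<Sum>c\<in>?C. N / real (\<Prod>D))" by simp
  have "\<bar>(\<Sum>c\<in>?C. real (card (?S c))) - (\<Sum>c\<in>?C. N / real (\<Prod>D))\<bar>
      = \<bar>\<Sum>c\<in>?C. real (card (?S c)) - N / real (\<Prod>D)\<bar>" by (simp only: sum_subtractf)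
  also have "\<dots> \<le> (\<Sum>c\<in>?C. \<bar>real (card (?S c)) - N / real (\<Prod>D)\<bar>)" by (rule sum_abs)
  also have "\<dots> \<le> (\<Sum>c\<in>?C. 1)"
    using R by (intro sum_mono card_crt_class D) (auto dest: PiE_mem)
  also have "\<dots> = (\<Prod>p\<in>D. real (card (R p)))" using D by (simp add: card_PiE)
  finally show ?thesis unfolding eq eq2 .
qed

section \<open>Truncated inclusion-exclusion and the sieve inequality\<close>

lemma sum_subsets_by_card:
  fixes f :: "nat \<Rightarrow> real"
  assumes "finite K"
  shows "(\<Sum>D | D \<subseteq> K \<and> card D \<le> b. f (card D)) = (\<Sum>i\<le>b. real (card K choose i) * f i)"
proof -
  let ?S = "{D. D \<subseteq> K \<and> card D \<le> b}"
  have fin: "finite ?S" by (rule finite_subset[of _ "Pow K"]) (use assms in auto)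
  have "(\<Sum>D\<in>?S. f (card D)) = (\<Sum>i\<le>b. \<Sum>D | D \<in> ?S \<and> card D = i. f (card D))"
    by (rule sum.group[symmetric]) (use fin in auto)
  also have "\<dots> = (\<Sum>i\<le>b. real (card K choose i) * f i)"
  proof (rule sum.cong[OF refl])
    fix i assume "i \<in> {..b}"
    then have "{D. D \<in> ?S \<and> card D = i} = {D. D \<subseteq> K \<and> card D = i}" by auto
    then show "(\<Sum>D | D \<in> ?S \<and> card D = i. f (card D)) = real (card K choose i) * f i"
      using n_subsets[OF assms, of i] by simp
  qed
  finally show ?thesis .
qed

text \<open>For finite \<open>P\<close> these are the terms of degree at most \<open>b\<close> in
  the expanded product of the \<open>1 + g p\<close>. With \<open>g\<close> minus an indicator it is
  inclusion-exclusion stopped at level \<open>b\<close>.\<close>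

definition truncated_expansion :: "nat \<Rightarrow> 'a set \<Rightarrow> ('a \<Rightarrow> real) \<Rightarrow> real" where
  "truncated_expansion b P g = (\<Sum>D | D \<subseteq> P \<and> card D \<le> b. \<Prod>p\<in>D. g p)"

lemma finite_bounded_subsets [simp]: "finite P \<Longrightarrow> finite {D. D \<subseteq> P \<and> card D \<le> b}"
  by (rule finite_subset[of _ "Pow P"]) auto

text \<open>If \<open>r\<close> of the events hold, the truncated alternating sum of binomials
  telescopes to \<open>(-1)^b * (r - 1 gchoose b)\<close>. For even \<open>b\<close> this is
  nonnegative when \<open>r \<ge> 1\<close>, and it is 1 when \<open>r = 0\<close>.\<close>

lemma bonferroni_even:
  assumes "finite P" "even b"
  shows "of_bool (\<forall>p\<in>P. \<not> E p) \<le> truncated_expansion b P (\<lambda>p. - of_bool (E p))"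
proof -
  let ?K = "{p \<in> P. E p}"
  have "truncated_expansion b P (\<lambda>p. - of_bool (E p)) =
      (\<Sum>D | D \<subseteq> ?K \<and> card D \<le> b. \<Prod>p\<in>D. - of_bool (E p))"
    unfolding truncated_expansion_def
  proof (rule sum.mono_neutral_right)
    show "\<forall>D\<in>{D. D \<subseteq> P \<and> card D \<le> b} - {D. D \<subseteq> ?K \<and> card D \<le> b}. (\<Prod>p\<in>D. - of_bool (E p)) = (0::real)"
      using assms(1) by (auto intro!: prod_zero finite_subset[of _ P])
  qed (use assms in auto)
  also have "\<dots> = (\<Sum>D | D \<subseteq> ?K \<and> card D \<le> b. (- 1) ^ card D)"
  proof (rule sum.cong[OF refl])
    fix D assume "D \<in> {D. D \<subseteq> ?K \<and> card D \<le> b}"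
    then have "(\<Prod>p\<in>D. - of_bool (E p)) = (\<Prod>p\<in>D. - 1 :: real)" by (intro prod.cong) auto
    then show "(\<Prod>p\<in>D. - of_bool (E p)) = (- 1 :: real) ^ card D" by simp
  qed
  also have "\<dots> = (\<Sum>i\<le>b. (real (card ?K) gchoose i) * (- 1) ^ i)"
    using assms(1) by (subst sum_subsets_by_card) (auto simp: binomial_gbinomial)
  also have "\<dots> = (real (card ?K) - 1 gchoose b)" using assms(2) by (simp add: gbinomial_sum_lower_neg)
  finally have eq: "truncated_expansion b P (\<lambda>p. - of_bool (E p)) = (real (card ?K) - 1 gchoose b)" .
  show ?thesis
  proof (cases "?K = {}")
    case True
    \<comment> \<open>The upper index is -1 here, which is why generalized binomials are used;
      \<open>-1 gchoose b\<close> is \<open>(-1)^b\<close>.\<close>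
    then have "(real (card ?K) - 1 gchoose b) = (- 1 gchoose b)" by (simp only: card.empty) simp
    also have "\<dots> = 1" using assms(2) by (subst gbinomial_negated_upper) (simp add: gbinomial_binomial[symmetric] flip: binomial_gbinomial)
    finally show ?thesis unfolding eq by simp
  next
    case False
    then have "card ?K \<ge> 1" using assms(1) by (simp add: Suc_le_eq card_gt_0_iff)
    then have "(real (card ?K) - 1 gchoose b) = real (card ?K - 1 choose b)"
      by (simp add: binomial_gbinomial of_nat_diff)
    then show ?thesis unfolding eq using False by auto
  qed
qed

text \<open>Truncating block by block still leaves a sum over sets of primes, one small subset from
  each block; each term can then be evaluated by \<open>card_residue_conditions\<close>.\<close>

lemma prod_truncated_expansion:
  assumes "finite I" "\<And>i. i \<in> I \<Longrightarrow> finite (P i)" "\<And>i j. i \<in> I \<Longrightarrow> j \<in> I \<Longrightarrow> i \<noteq> j \<Longrightarrow> P i \<inter> P j = {}"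
  shows "(\<Prod>i\<in>I. truncated_expansion (b i) (P i) g) =
    (\<Sum>G\<in>(\<Pi>\<^sub>E i\<in>I. {D. D \<subseteq> P i \<and> card D \<le> b i}). \<Prod>p\<in>(\<Union>i\<in>I. G i). g p)"
proof -
  let ?D = "\<lambda>i. {D. D \<subseteq> P i \<and> card D \<le> b i}"
  have "(\<Prod>i\<in>I. truncated_expansion (b i) (P i) g) = (\<Sum>G\<in>PiE I ?D. \<Prod>i\<in>I. \<Prod>p\<in>G i. g p)"
    unfolding truncated_expansion_def using assms by (intro prod_sum_PiE) auto
  also have "\<dots> = (\<Sum>G\<in>PiE I ?D. \<Prod>p\<in>(\<Union>i\<in>I. G i). g p)"
  proof (rule sum.cong[OF refl])
    fix G assume "G \<in> PiE I ?D"
    then have G: "G i \<subseteq> P i" if "i \<in> I" for i using that by (auto dest: PiE_mem)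
    have "finite (G i)" if "i \<in> I" for i using G[OF that] assms(2)[OF that] by (rule finite_subset)
    moreover have "G i \<inter> G j = {}" if "i \<in> I" "j \<in> I" "i \<noteq> j" for i j
      using G[OF that(1)] G[OF that(2)] assms(3)[OF that] by blast
    ultimately show "(\<Prod>i\<in>I. \<Prod>p\<in>G i. g p) = (\<Prod>p\<in>(\<Union>i\<in>I. G i). g p)"
      using assms(1) by (intro prod.UNION_disjoint[symmetric]) auto
  qed
  finally show ?thesis .
qed

lemma sum_of_bool_lessThan: "(\<Sum>m<N. of_bool (Q m)) = real (card {m. m < N \<and> Q m})" for N :: nat
proof -
  have "{..<N} \<inter> {m. Q m} = {m. m < N \<and> Q m}" by auto
  then show ?thesis by simp
qed

lemma prod_of_bool: "finite I \<Longrightarrow> (\<Prod>i\<in>I. of_bool (Q i)) = (of_bool (\<forall>i\<in>I. Q i) :: real)"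
  by (induction I rule: finite_induct) auto

text \<open>The indicator of surviving all blocks is the product of the block indicators. These are
  nonnegative, so each may be replaced by its even Bonferroni majorant. Expanding and summing over
  \<open>m\<close> first turns every term into a count with residue conditions.\<close>

theorem brun_hooley:
  fixes P :: "'i \<Rightarrow> nat set" and N :: nat
  assumes I: "finite I" and P: "\<And>i. i \<in> I \<Longrightarrow> finite (P i)" "\<And>i p. i \<in> I \<Longrightarrow> p \<in> P i \<Longrightarrow> prime p"
    and disj: "\<And>i j. i \<in> I \<Longrightarrow> j \<in> I \<Longrightarrow> i \<noteq> j \<Longrightarrow> P i \<inter> P j = {}"
    and b: "\<And>i. i \<in> I \<Longrightarrow> even (b i)"
    and R: "\<And>i p. i \<in> I \<Longrightarrow> p \<in> P i \<Longrightarrow> R p \<subseteq> {..<p}"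
  shows "real (card {m. m < N \<and> (\<forall>i\<in>I. \<forall>p\<in>P i. m mod p \<notin> R p)}) \<le>
     N * (\<Prod>i\<in>I. truncated_expansion (b i) (P i) (\<lambda>p. - (card (R p) / real p)))
     + (\<Prod>i\<in>I. truncated_expansion (b i) (P i) (\<lambda>p. real (card (R p))))"
proof -
  let ?G = "\<Pi>\<^sub>E i\<in>I. {D. D \<subseteq> P i \<and> card D \<le> b i}" and ?U = "\<lambda>G. \<Union>i\<in>I. G i"
  have "real (card {m. m < N \<and> (\<forall>i\<in>I. \<forall>p\<in>P i. m mod p \<notin> R p)}) =
      (\<Sum>m\<in>{..<N}. of_bool (\<forall>i\<in>I. \<forall>p\<in>P i. m mod p \<notin> R p))"
    by (rule sum_of_bool_lessThan[symmetric])
  also have "\<dots> = (\<Sum>m<N. \<Prod>i\<in>I. of_bool (\<forall>p\<in>P i. m mod p \<notin> R p))"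
    using I by (simp only: prod_of_bool)
  also have "\<dots> \<le> (\<Sum>m<N. \<Prod>i\<in>I. truncated_expansion (b i) (P i) (\<lambda>p. - of_bool (m mod p \<in> R p)))"
    using bonferroni_even[OF P(1) b] by (intro sum_mono prod_mono) auto
  also have "\<dots> = (\<Sum>m<N. \<Sum>G\<in>?G. \<Prod>p\<in>?U G. - of_bool (m mod p \<in> R p))"
    using I P disj by (simp add: prod_truncated_expansion)
  also have "\<dots> = (\<Sum>G\<in>?G. \<Sum>m<N. \<Prod>p\<in>?U G. - of_bool (m mod p \<in> R p))" by (rule sum.swap)
  also have "\<dots> \<le> (\<Sum>G\<in>?G. N * (\<Prod>p\<in>?U G. - (card (R p) / real p)) + (\<Prod>p\<in>?U G. real (card (R p))))"
  proof (rule sum_mono)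
    fix G assume G: "G \<in> ?G"
    define U where "U = ?U G"
    have Gi: "G i \<subseteq> P i" if "i \<in> I" for i using that G by (auto dest: PiE_mem)
    have fin: "finite U"
      unfolding U_def using I Gi P(1) by (intro finite_UN_I) (auto intro: finite_subset)
    have "\<exists>i\<in>I. p \<in> P i" if "p \<in> U" for p using that Gi unfolding U_def by blast
    then have U: "\<And>p. p \<in> U \<Longrightarrow> prime p" "\<And>p. p \<in> U \<Longrightarrow> R p \<subseteq> {..<p}"
      using P(2) R by metis+
    have "(\<Prod>p\<in>U. - of_bool (m mod p \<in> R p)) = (- 1 :: real) ^ card U * of_bool (\<forall>p\<in>U. m mod p \<in> R p)" for m
      using fin by (induction U rule: finite_induct) auto
    then have "(\<Sum>m<N. \<Prod>p\<in>U. - of_bool (m mod p \<in> R p)) =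
        (- 1 :: real) ^ card U * real (card {m. m < N \<and> (\<forall>p\<in>U. m mod p \<in> R p)})"
      by (simp only: sum_distrib_left[symmetric] sum_of_bool_lessThan)
    \<comment> \<open>The count is approximated from both sides, so its error can be added whatever
      the sign of the term.\<close>
    also have "\<dots> \<le> (- 1) ^ card U * (N * (\<Prod>p\<in>U. card (R p) / real p)) + (\<Prod>p\<in>U. real (card (R p)))"
      using card_residue_conditions[OF fin U, of N] by (cases "even (card U)") auto
    also have "(- 1) ^ card U * (N * (\<Prod>p\<in>U. card (R p) / real p)) = N * (\<Prod>p\<in>U. - (card (R p) / real p))"
      by (simp only: prod_uminus) simp
    finally show "(\<Sum>m<N. \<Prod>p\<in>?U G. - of_bool (m mod p \<in> R p)) \<le>
        N * (\<Prod>p\<in>?U G. - (card (R p) / real p)) + (\<Prod>p\<in>?U G. real (card (R p)))"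
      unfolding U_def .
  qed
  also have "\<dots> = N * (\<Prod>i\<in>I. truncated_expansion (b i) (P i) (\<lambda>p. - (card (R p) / real p)))
     + (\<Prod>i\<in>I. truncated_expansion (b i) (P i) (\<lambda>p. real (card (R p))))"
    using I P disj by (simp add: prod_truncated_expansion sum.distrib sum_distrib_left)
  finally show ?thesis .
qed

section \<open>Bounds for truncated expansions\<close>

lemma expansion_all_subsets:
  fixes g :: "'a \<Rightarrow> real"
  assumes "finite P"
  shows "(\<Prod>p\<in>P. 1 + g p) = (\<Sum>D\<in>Pow P. \<Prod>p\<in>D. g p)"
  using prod_add[OF assms, of g "\<lambda>_. 1"] by (simp add: add.commute)

text \<open>Rankin's trick: the tail over \<^term>\<open>card D > b\<close> is weighted by \<^term>\<open>2 ^ (card D - b) \<ge> (1::real)\<close>.\<close>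

lemma truncated_expansion_error_rankin:
  fixes g :: "'a \<Rightarrow> real"
  assumes "finite P" "\<And>p. p \<in> P \<Longrightarrow> 0 \<le> g p"
  shows "\<bar>truncated_expansion b P (\<lambda>p. - g p) - (\<Prod>p\<in>P. 1 - g p)\<bar> \<le> (\<Prod>p\<in>P. 1 + 2 * g p) / 2 ^ b"
proof -
  let ?T = "{D. D \<subseteq> P \<and> card D \<le> b}" and ?T' = "{D. D \<subseteq> P \<and> b < card D}"
  have T: "Pow P = ?T \<union> ?T'" "?T \<inter> ?T' = {}" by auto
  have fin: "finite ?T" "finite ?T'" using assms(1) T(1) by (metis finite_Pow_iff finite_Un)+
  have g0: "0 \<le> (\<Prod>p\<in>D. g p)" if "D \<in> Pow P" for D using that assms(2) by (intro prod_nonneg) auto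
  have "(\<Prod>p\<in>P. 1 - g p) = (\<Sum>D\<in>Pow P. \<Prod>p\<in>D. - g p)"
    using expansion_all_subsets[OF assms(1), of "\<lambda>p. - g p"] by simp
  also have "\<dots> = truncated_expansion b P (\<lambda>p. - g p) + (\<Sum>D\<in>?T'. \<Prod>p\<in>D. - g p)"
    unfolding T(1) truncated_expansion_def using fin T(2) by (rule sum.union_disjoint)
  finally have "\<bar>truncated_expansion b P (\<lambda>p. - g p) - (\<Prod>p\<in>P. 1 - g p)\<bar> = \<bar>\<Sum>D\<in>?T'. \<Prod>p\<in>D. - g p\<bar>"
    by simp
  also have "\<dots> \<le> (\<Sum>D\<in>?T'. \<bar>\<Prod>p\<in>D. - g p\<bar>)" by (rule sum_abs)
  also have "\<dots> \<le> (\<Sum>D\<in>?T'. (\<Prod>p\<in>D. 2 * g p) / 2 ^ b)"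
  proof (rule sum_mono)
    fix D assume D: "D \<in> ?T'"
    then have g: "0 \<le> (\<Prod>p\<in>D. g p)" using g0 by auto
    have "\<bar>\<Prod>p\<in>D. - g p\<bar> = 1 * (\<Prod>p\<in>D. g p)"
      using D assms(2) by (auto simp: abs_prod intro!: prod.cong)
    also have "\<dots> \<le> 2 ^ card D / 2 ^ b * (\<Prod>p\<in>D. g p)"
    proof (rule mult_right_mono[OF _ g])
      have "(2::real) ^ b \<le> 2 ^ card D" using D by (intro power_increasing) auto
      then show "(1::real) \<le> 2 ^ card D / 2 ^ b" by simp
    qed
    finally show "\<bar>\<Prod>p\<in>D. - g p\<bar> \<le> (\<Prod>p\<in>D. 2 * g p) / 2 ^ b"
      by (simp add: prod.distrib)
  qed
  also have "\<dots> \<le> (\<Sum>D\<in>Pow P. (\<Prod>p\<in>D. 2 * g p) / 2 ^ b)"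
    using assms g0 by (intro sum_mono2) (auto simp: prod.distrib)
  also have "\<dots> = (\<Prod>p\<in>P. 1 + 2 * g p) / 2 ^ b"
    using expansion_all_subsets[OF assms(1), of "\<lambda>p. 2 * g p"] by (simp add: sum_divide_distrib)
  finally show ?thesis .
qed

text \<open>Turns Rankin's error into a relative one: the product of the \<open>1 + 2 * g p\<close>
  is at most \<open>exp (2 * L)\<close>, the full product \<open>?V\<close> is at least
  \<open>exp (- (3 * L))\<close>, so the error is at most \<open>?V * exp (5 * L) / 2 ^ b\<close>.
  Writing \<open>1 + x\<close> as at most \<open>exp x\<close> lets the errors of several blocks add
  up in an exponent.\<close>

lemma truncated_expansion_le_prod:
  fixes g :: "'a \<Rightarrow> real"
  assumes "finite P" and g: "\<And>p. p \<in> P \<Longrightarrow> 0 \<le> g p" "\<And>p. p \<in> P \<Longrightarrow> g p \<le> 2 / 3"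
    and L: "(\<Sum>p\<in>P. g p) \<le> L"
  shows "\<bar>truncated_expansion b P (\<lambda>p. - g p)\<bar> \<le> (\<Prod>p\<in>P. 1 - g p) * exp (exp (5 * L) / 2 ^ b)"
proof -
  let ?V = "\<Prod>p\<in>P. 1 - g p"
  have "(\<Prod>p\<in>P. 1 + 2 * g p) \<le> (\<Prod>p\<in>P. exp (2 * g p))"
    using g by (intro prod_mono conjI exp_ge_add_one_self) (auto intro: add_nonneg_nonneg)
  also have "\<dots> = exp (2 * (\<Sum>p\<in>P. g p))" using assms(1) by (simp add: exp_sum sum_distrib_left)
  also have "\<dots> \<le> exp (2 * L)" using L by simp
  finally have 1: "(\<Prod>p\<in>P. 1 + 2 * g p) \<le> exp (2 * L)" .
  have "exp (- (3 * L)) \<le> exp (\<Sum>p\<in>P. - (3 * g p))"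
    using L by (simp add: sum_negf sum_distrib_left[symmetric])
  also have "\<dots> = (\<Prod>p\<in>P. exp (- (3 * g p)))" using assms(1) by (rule exp_sum)
  also have "\<dots> \<le> ?V"
  proof (intro prod_mono conjI)
    fix p assume p: "p \<in> P"
    \<comment> \<open>The difference of the two sides is \<open>g p * (2 - 3 * g p)\<close>, whence
      the hypothesis \<open>g p \<le> 2 / 3\<close>; two residues modulo 3 attain it.\<close>
    have "1 \<le> (1 - g p) * (1 + 3 * g p)"
      using mult_nonneg_nonneg[of "g p" "2 - 3 * g p"] g[OF p] by (simp add: algebra_simps)
    also have "\<dots> \<le> (1 - g p) * exp (3 * g p)"
      using g[OF p] by (intro mult_left_mono exp_ge_add_one_self) auto
    finally show "exp (- (3 * g p)) \<le> 1 - g p" by (simp add: exp_minus field_simps)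
  qed simp
  finally have 2: "exp (- (3 * L)) \<le> ?V" .
  have "exp (2 * L) = exp (- (3 * L)) * exp (5 * L)" by (simp flip: exp_add)
  also have "\<dots> \<le> ?V * exp (5 * L)" using 2 by (intro mult_right_mono) auto
  finally have 3: "(\<Prod>p\<in>P. 1 + 2 * g p) \<le> ?V * exp (5 * L)" using 1 by linarith
  have "\<bar>truncated_expansion b P (\<lambda>p. - g p) - ?V\<bar> \<le> (\<Prod>p\<in>P. 1 + 2 * g p) / 2 ^ b"
    using assms by (intro truncated_expansion_error_rankin) auto
  moreover have "0 \<le> ?V" using 2 by (rule order_trans[rotated]) simp
  ultimately have "\<bar>truncated_expansion b P (\<lambda>p. - g p)\<bar> \<le> ?V + (\<Prod>p\<in>P. 1 + 2 * g p) / 2 ^ b"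
    by linarith
  also have "\<dots> \<le> ?V + ?V * exp (5 * L) / 2 ^ b"
    using 3 by (intro add_left_mono divide_right_mono) auto
  also have "\<dots> = ?V * (1 + exp (5 * L) / 2 ^ b)" by (simp add: algebra_simps)
  also have "\<dots> \<le> ?V * exp (exp (5 * L) / 2 ^ b)"
    using 2 by (intro mult_left_mono exp_ge_add_one_self) (auto intro: order_trans[of 0 "exp (- (3 * L))"])
  finally show ?thesis .
qed

text \<open>The gain from truncation: a polynomial of degree \<open>b\<close> in
  \<open>card P\<close>, where the full expansion could be as large as
  \<open>3 ^ card P\<close>.\<close>

lemma truncated_expansion_le_power:
  assumes "finite P" "\<And>p. p \<in> P \<Longrightarrow> 0 \<le> c p \<and> c p \<le> 2"
  shows "truncated_expansion b P c \<le> (1 + 2 * real (card P)) ^ b"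
proof -
  have "truncated_expansion b P c \<le> (\<Sum>D | D \<subseteq> P \<and> card D \<le> b. 2 ^ card D)"
    unfolding truncated_expansion_def
  proof (rule sum_mono)
    fix D assume D: "D \<in> {D. D \<subseteq> P \<and> card D \<le> b}"
    have "(\<Prod>p\<in>D. c p) \<le> (\<Prod>p\<in>D. 2)" using D assms(2) by (intro prod_mono) auto
    then show "(\<Prod>p\<in>D. c p) \<le> 2 ^ card D" by simp
  qed
  also have "\<dots> = (\<Sum>i\<le>b. real (card P choose i) * 2 ^ i)" by (rule sum_subsets_by_card[OF assms(1)])
  also have "\<dots> \<le> (\<Sum>i\<le>b. (2 * real (card P)) ^ i)"
  proof (rule sum_mono)
    fix i
    have "card P choose i \<le> card P ^ i" by (cases "i \<le> card P") (auto simp: binomial_le_pow binomial_eq_0)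
    then have "real (card P choose i) \<le> real (card P ^ i)" by (rule of_nat_mono)
    then show "real (card P choose i) * 2 ^ i \<le> (2 * real (card P)) ^ i" by (simp add: power_mult_distrib)
  qed
  also have "\<dots> \<le> (1 + 2 * real (card P)) ^ b"
  proof (induction b)
    case (Suc b)
    let ?y = "2 * real (card P)"
    have "?y ^ Suc b = ?y * ?y ^ b" by simp
    also have "\<dots> \<le> ?y * (1 + ?y) ^ b" by (intro mult_left_mono power_mono) auto
    finally show ?case using Suc by (simp add: algebra_simps)
  qed simp
  finally show ?thesis .
qed

section \<open>Sifting for pairs of primes\<close>

definition prime_block :: "nat \<Rightarrow> nat set" where
  "prime_block i = {p. prime p \<and> 2 ^ (2 ^ i) < p \<and> p \<le> 2 ^ (2 ^ Suc i)}"

text \<open>The prime 2 is left out, since two forbidden residues modulo 2 would leave nothing; for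
  the other primes they fill at most 2/3 of the residues.\<close>

definition sifting_primes :: "nat \<Rightarrow> nat set" where
  "sifting_primes J = {p. prime p \<and> 2 < p \<and> p \<le> 2 ^ (2 ^ J)}"

text \<open>Residues \<open>m\<close> modulo \<open>p\<close> for which \<open>p\<close> divides \<open>m\<close> or \<open>n - m\<close>.\<close>

definition forbidden :: "nat \<Rightarrow> nat \<Rightarrow> nat set" where
  "forbidden n p = {0, n mod p}"

text \<open>The arithmetic factor of the sieve bound: at primes dividing \<open>n\<close> the two
  forbidden residues coincide, and one factor \<open>1 - 1 / p\<close> has to be given back.\<close>

definition local_factor :: "nat \<Rightarrow> nat \<Rightarrow> real" where
  "local_factor J n = (\<Prod>p\<in>sifting_primes J. if p dvd n then 1 / (1 - 1 / p) else 1)"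

lemma finite_prime_block [simp]: "finite (prime_block i)"
  unfolding prime_block_def by (rule finite_subset[OF _ finite_primes_le]) auto

lemma finite_sifting_primes [simp]: "finite (sifting_primes J)"
  unfolding sifting_primes_def by (rule finite_subset[OF _ finite_primes_le]) auto

lemma two_le_two_power: "(2::nat) \<le> 2 ^ (2 ^ J)"
  using power_increasing[of 1 "2 ^ J" "2::nat"] by simp

lemma UN_prime_block: "(\<Union>i<J. prime_block i) = sifting_primes J"
proof (induction J)
  case (Suc J)
  have "(2::nat) ^ (2 ^ J) \<le> 2 ^ (2 ^ Suc J)" by (intro power_increasing) auto
  with two_le_two_power[of J] have "sifting_primes (Suc J) = sifting_primes J \<union> prime_block J"
    unfolding sifting_primes_def prime_block_def by (auto simp del: power_increasing_iff power_Suc)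
  then show ?case using Suc by (auto simp: lessThan_Suc)
qed (auto simp: sifting_primes_def)

lemma prime_block_disjoint_less: "i < j \<Longrightarrow> prime_block i \<inter> prime_block j = {}"
proof -
  assume "i < j"
  then have "(2::nat) ^ (2 ^ Suc i) \<le> 2 ^ (2 ^ j)" by (intro power_increasing) auto
  then show ?thesis unfolding prime_block_def by (auto simp del: power_increasing_iff power_Suc)
qed

lemma prime_block_disjoint: "i \<noteq> j \<Longrightarrow> prime_block i \<inter> prime_block j = {}"
  using prime_block_disjoint_less[of i j] prime_block_disjoint_less[of j i] by (metis Int_commute nat_neq_iff)

lemma prod_sifting_primes: "(\<Prod>p\<in>sifting_primes J. f p) = (\<Prod>i<J. \<Prod>p\<in>prime_block i. f p)"
  unfolding UN_prime_block[symmetric]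
  by (rule prod.UNION_disjoint) (auto dest: prime_block_disjoint)

lemma prime_block_ge_3: "p \<in> prime_block i \<Longrightarrow> prime p \<and> 3 \<le> p"
  using two_le_two_power[of i] by (auto simp: prime_block_def)

lemma sum_reciprocals_prime_block: "(\<Sum>p\<in>prime_block i. 1 / real p) \<le> 2"
  using sum_prime_reciprocals_dyadic[of "2 ^ i" "2 ^ i"] by (simp add: prime_block_def mult_2)

lemma card_prime_block: "1 + 2 * card (prime_block i) \<le> 2 ^ (2 ^ (i + 2))"
proof -
  let ?w = "(2::nat) ^ (2 ^ Suc i)"
  have "card (prime_block i) \<le> card {1..?w}"
    by (intro card_mono) (auto simp: prime_block_def)
  then have "card (prime_block i) \<le> ?w" by simp
  moreover have "(2::nat) ^ 2 \<le> ?w" by (intro power_increasing) auto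
  then have "4 \<le> ?w" by simp
  then have "4 * ?w \<le> ?w * ?w" by (intro mult_right_mono) auto
  moreover have "?w * ?w = 2 ^ (2 ^ (i + 2))" by (simp flip: power_add)
  ultimately show ?thesis using \<open>4 \<le> ?w\<close> by linarith
qed

lemma card_forbidden: "card (forbidden n p) = (if p dvd n then 1 else 2)"
  by (auto simp: forbidden_def dvd_eq_mod_eq_0 card_insert_if)

lemma sum_weights_le: "(\<Sum>i<J. 1 / 2 ^ (2 * (J - i))) \<le> (1::real)"
proof (induction J)
  case (Suc J)
  have "(\<Sum>i<J. 1 / 2 ^ (2 * (Suc J - i))) = (\<Sum>i<J. 1 / 2 ^ (2 * (J - i)) / (4::real))"
    by (intro sum.cong) (auto simp: Suc_diff_le)
  also have "\<dots> = (\<Sum>i<J. 1 / 2 ^ (2 * (J - i))) / 4" by (rule sum_divide_distrib[symmetric])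
  finally show ?case using Suc by simp
qed simp

text \<open>Only the resulting bound \<open>2 ^ Suc J\<close> is used later; the exact value makes
  the induction go through.\<close>

lemma sum_exponents: "(\<Sum>i<J. 2 ^ i * (J - i)) + J + 2 = (2::nat) ^ Suc J"
proof (induction J)
  case (Suc J)
  have "(\<Sum>i<Suc J. 2 ^ i * (Suc J - i)) = (\<Sum>i<Suc J. 2 ^ i * (J - i) + 2 ^ i)"
    by (intro sum.cong) (auto simp: Suc_diff_le)
  also have "\<dots> = (\<Sum>i<J. 2 ^ i * (J - i)) + (\<Sum>i<Suc J. 2 ^ i)" by (simp add: sum.distrib)
  also have "(\<Sum>i<Suc J. 2 ^ i) = (2::nat) ^ Suc J - 1" by (induction J) auto
  finally show ?case using Suc by simp
qed simp

text \<open>The truncation levels \<open>2 (J - i)\<close> grow towards the small primes: slowly enough that the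
  total degree \<open>\<Sum>i. 2 ^ (i + 2) * 2 (J - i)\<close> of the error is \<open>O(2 ^ J)\<close>, fast enough that the
  relative errors \<open>O(4 ^ (i - J))\<close> of the blocks are summable.\<close>

lemma sieve_main_term:
  "\<bar>\<Prod>i<J. truncated_expansion (2 * (J - i)) (prime_block i) (\<lambda>p. - (card (forbidden n p) / real p))\<bar>
     \<le> (\<Prod>p\<in>sifting_primes J. 1 - card (forbidden n p) / real p) * exp (exp 20)"
proof -
  let ?g = "\<lambda>p. card (forbidden n p) / real p"
  have g: "0 \<le> ?g p" "?g p \<le> 2 / 3" "?g p \<le> 2 * (1 / p)" if "p \<in> prime_block i" for p i
    using prime_block_ge_3[OF that] by (auto simp: card_forbidden field_simps)
  \<comment> \<open>At most two residues per prime and a reciprocal sum of at most 2. The 20 in the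
    final constant is \<open>5 * 4\<close>.\<close>
  have L: "(\<Sum>p\<in>prime_block i. ?g p) \<le> 4" for i
  proof -
    have "(\<Sum>p\<in>prime_block i. ?g p) \<le> (\<Sum>p\<in>prime_block i. 2 * (1 / real p))"
      by (intro sum_mono g(3))
    also have "\<dots> = 2 * (\<Sum>p\<in>prime_block i. 1 / real p)" by (simp add: sum_distrib_left)
    finally show ?thesis using sum_reciprocals_prime_block[of i] by linarith
  qed
  have "\<bar>\<Prod>i<J. truncated_expansion (2 * (J - i)) (prime_block i) (\<lambda>p. - ?g p)\<bar>
      \<le> (\<Prod>i<J. (\<Prod>p\<in>prime_block i. 1 - ?g p) * exp (exp (5 * 4) / 2 ^ (2 * (J - i))))"
    unfolding abs_prod using g L by (intro prod_mono conjI truncated_expansion_le_prod) auto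
  also have "\<dots> = (\<Prod>p\<in>sifting_primes J. 1 - ?g p) * exp (\<Sum>i<J. exp 20 * (1 / 2 ^ (2 * (J - i))))"
    by (simp add: prod.distrib prod_sifting_primes exp_sum)
  also have "\<dots> \<le> (\<Prod>p\<in>sifting_primes J. 1 - ?g p) * exp (exp 20)"
  proof (intro mult_left_mono prod_nonneg ballI)
    have "exp 20 * (\<Sum>i<J. 1 / 2 ^ (2 * (J - i))) \<le> exp 20 * (1::real)"
      by (intro mult_left_mono sum_weights_le) auto
    then show "exp (\<Sum>i<J. exp 20 * (1 / 2 ^ (2 * (J - i)))) \<le> exp (exp (20::real))"
      by (simp only: sum_distrib_left exp_le_cancel_iff mult_1_right)
    fix p assume "p \<in> sifting_primes J"
    then obtain i where "p \<in> prime_block i" unfolding UN_prime_block[symmetric] by auto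
    from g(2)[OF this] show "0 \<le> 1 - ?g p" by linarith
  qed
  finally show ?thesis .
qed

text \<open>Block \<open>i\<close> contributes at most \<open>2 ^ (8 * (2 ^ i * (J - i)))\<close>,
  and by \<open>sum_exponents\<close> the exponents add up to at most
  \<open>8 * 2 ^ Suc J\<close>.\<close>

lemma sieve_error_term:
  "(\<Prod>i<J. truncated_expansion (2 * (J - i)) (prime_block i) (\<lambda>p. real (card (forbidden n p)))) \<le> 2 ^ (16 * 2 ^ J)"
proof -
  have "(\<Prod>i<J. truncated_expansion (2 * (J - i)) (prime_block i) (\<lambda>p. real (card (forbidden n p))))
      \<le> (\<Prod>i<J. (2 ^ (2 ^ (i + 2))) ^ (2 * (J - i)))"
  proof (intro prod_mono conjI)
    fix i
    show "0 \<le> truncated_expansion (2 * (J - i)) (prime_block i) (\<lambda>p. real (card (forbidden n p)))"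
      unfolding truncated_expansion_def by (intro sum_nonneg prod_nonneg) auto
    have "truncated_expansion (2 * (J - i)) (prime_block i) (\<lambda>p. real (card (forbidden n p)))
        \<le> (1 + 2 * real (card (prime_block i))) ^ (2 * (J - i))"
      by (rule truncated_expansion_le_power) (auto simp: card_forbidden)
    also have "\<dots> \<le> (2 ^ (2 ^ (i + 2))) ^ (2 * (J - i))"
    proof (intro power_mono)
      have "real (1 + 2 * card (prime_block i)) \<le> real (2 ^ (2 ^ (i + 2)))"
        by (intro of_nat_mono card_prime_block)
      then show "1 + 2 * real (card (prime_block i)) \<le> 2 ^ (2 ^ (i + 2))" by simp
    qed simp
    finally show "truncated_expansion (2 * (J - i)) (prime_block i) (\<lambda>p. real (card (forbidden n p)))
        \<le> (2 ^ (2 ^ (i + 2))) ^ (2 * (J - i))" .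
  qed
  also have "\<dots> = 2 ^ (\<Sum>i<J. 8 * (2 ^ i * (J - i)))"
    by (simp add: power_sum power_mult[symmetric] mult_ac)
  also have "\<dots> \<le> 2 ^ (16 * 2 ^ J)"
  proof (rule power_increasing)
    have "8 * (\<Sum>i<J. 2 ^ i * (J - i)) \<le> 8 * 2 ^ Suc J" using sum_exponents[of J] by linarith
    then show "(\<Sum>i<J. 8 * (2 ^ i * (J - i))) \<le> 16 * 2 ^ J" by (simp add: sum_distrib_left)
  qed simp
  finally show ?thesis .
qed

text \<open>The Mertens bound at exponent \<open>2 ^ J\<close>, inverted; removing the prime 2 costs
  its Euler factor, another 2.\<close>

lemma mertens_sifting_primes: "(\<Prod>p\<in>sifting_primes J. 1 - 1 / real p) \<le> 4 / 2 ^ J"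
proof -
  have "p = 2 \<or> 2 < p" if "prime p" for p :: nat using prime_ge_2_nat[OF that] by linarith
  then have "{p. prime p \<and> p \<le> 2 ^ (2 ^ J)} = insert 2 (sifting_primes J)"
    using two_le_two_power[of J] two_is_prime_nat unfolding sifting_primes_def by blast
  moreover have "2 \<notin> sifting_primes J" by (simp add: sifting_primes_def)
  ultimately have "2 ^ J / 2 \<le> 2 * (\<Prod>p\<in>sifting_primes J. 1 / (1 - 1 / real p))"
    using mertens_product_lower[of "2 ^ J"] by simp
  also have "(\<Prod>p\<in>sifting_primes J. 1 / (1 - 1 / real p)) = 1 / (\<Prod>p\<in>sifting_primes J. 1 - 1 / real p)"
    by (simp add: prod_dividef)
  finally have "2 ^ J / 4 \<le> 1 / (\<Prod>p\<in>sifting_primes J. 1 - 1 / real p)" by simp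
  moreover have "0 < (\<Prod>p\<in>sifting_primes J. 1 - 1 / real p)"
    by (intro prod_pos) (auto simp: sifting_primes_def)
  ultimately show ?thesis by (simp add: field_simps)
qed

text \<open>For \<open>p\<close> not dividing \<open>n\<close>,
  \<open>1 - 2 / p \<le> (1 - 1 / p)\<^sup>2\<close>; for \<open>p\<close> dividing
  \<open>n\<close>, \<open>local_factor\<close> restores equality. The square of the Mertens product
  then gives \<open>16 / 4 ^ J\<close>.\<close>

lemma sifting_density:
  "(\<Prod>p\<in>sifting_primes J. 1 - card (forbidden n p) / real p) \<le> 16 / 4 ^ J * local_factor J n"
proof -
  let ?Q = "sifting_primes J"
  have "(\<Prod>p\<in>?Q. 1 - card (forbidden n p) / real p) \<le>
      (\<Prod>p\<in>?Q. (1 - 1 / real p)\<^sup>2 * (if p dvd n then 1 / (1 - 1 / p) else 1))"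
  proof (intro prod_mono conjI)
    fix p assume "p \<in> ?Q"
    then have p: "real p \<ge> 3" by (auto simp: sifting_primes_def)
    show "0 \<le> 1 - card (forbidden n p) / real p" using p by (simp add: card_forbidden field_simps)
    show "1 - card (forbidden n p) / real p \<le> (1 - 1 / real p)\<^sup>2 * (if p dvd n then 1 / (1 - 1 / p) else 1)"
    proof (cases "p dvd n")
      case True
      have "(1 - 1 / real p)\<^sup>2 * (1 / (1 - 1 / p)) = 1 - 1 / p" using p by (simp add: power2_eq_square)
      then show ?thesis using True by (simp add: card_forbidden)
    qed (simp add: card_forbidden power2_eq_square algebra_simps)
  qed
  also have "\<dots> = (\<Prod>p\<in>?Q. 1 - 1 / real p)\<^sup>2 * local_factor J n"
    by (simp add: prod.distrib prod_power_distrib local_factor_def)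
  also have "\<dots> \<le> (4 / 2 ^ J)\<^sup>2 * local_factor J n"
  proof (intro mult_right_mono power_mono mertens_sifting_primes prod_nonneg)
    show "0 \<le> local_factor J n" unfolding local_factor_def
      by (intro prod_nonneg) (auto simp: sifting_primes_def)
  qed (auto simp: sifting_primes_def)
  also have "(4 / 2 ^ J)\<^sup>2 = (16 / 4 ^ J :: real)"
    by (simp add: power_divide power2_eq_square flip: power_mult_distrib)
  finally show ?thesis .
qed

text \<open>It is applied with \<open>N = 2 ^ k\<close> and \<open>2 ^ J\<close> of the order of
  \<open>k\<close>, so that \<open>4 ^ J\<close> plays the part of the squared logarithm, while the
  last term is at most the square root of \<open>N\<close>.\<close>

theorem sieve_upper_bound:
  fixes N :: nat
  shows
  "real (card {m. m < N \<and> (\<forall>p\<in>sifting_primes J. m mod p \<notin> forbidden n p)})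
     \<le> N * (16 * exp (exp 20) / 4 ^ J * local_factor J n) + 2 ^ (16 * 2 ^ J)"
proof -
  have "real (card {m. m < N \<and> (\<forall>i\<in>{..<J}. \<forall>p\<in>prime_block i. m mod p \<notin> forbidden n p)})
     \<le> N * (\<Prod>i<J. truncated_expansion (2 * (J - i)) (prime_block i) (\<lambda>p. - (card (forbidden n p) / real p)))
     + (\<Prod>i<J. truncated_expansion (2 * (J - i)) (prime_block i) (\<lambda>p. real (card (forbidden n p))))"
  proof (rule brun_hooley)
    show "forbidden n p \<subseteq> {..<p}" if "p \<in> prime_block i" for i p
      using prime_block_ge_3[OF that] by (auto simp: forbidden_def)
  qed (auto dest: prime_block_disjoint prime_block_ge_3)
  also have "\<dots> \<le> N * (16 / 4 ^ J * local_factor J n * exp (exp 20)) + 2 ^ (16 * 2 ^ J)"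
  proof (intro add_mono sieve_error_term mult_left_mono)
    show "(\<Prod>i<J. truncated_expansion (2 * (J - i)) (prime_block i) (\<lambda>p. - (card (forbidden n p) / real p)))
        \<le> 16 / 4 ^ J * local_factor J n * exp (exp 20)"
      using order_trans[OF sieve_main_term mult_right_mono[OF sifting_density]] by (simp add: abs_le_iff)
  qed simp
  finally show ?thesis unfolding UN_prime_block[symmetric] by (simp add: mult_ac)
qed

section \<open>Density of the sums of two odd primes\<close>

lemma local_factor_ge_1: "1 \<le> local_factor J n"
  unfolding local_factor_def by (intro prod_ge_1) (auto simp: sifting_primes_def field_simps)

text \<open>Counting from 1 leaves no rounding term. This matters because the bound is later summed
  over all sets of sifting primes.\<close>

lemma card_common_multiples_le:
  fixes D :: "nat set" and M :: nat
  assumes "finite D" "\<And>p. p \<in> D \<Longrightarrow> prime p"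
  shows "real (card {n \<in> {1..M}. \<forall>p\<in>D. p dvd n}) \<le> M / real (\<Prod>D)"
proof -
  have pos: "\<Prod>D > 0" using assms by (intro prod_pos) (auto simp: prime_gt_0_nat)
  have "{n \<in> {1..M}. \<forall>p\<in>D. p dvd n} \<subseteq> (*) (\<Prod>D) ` {1..M div \<Prod>D}"
  proof
    fix n assume n: "n \<in> {n \<in> {1..M}. \<forall>p\<in>D. p dvd n}"
    then have "\<Prod>D dvd n" using assms by (intro prod_primes_dvd) auto
    then obtain t where t: "n = \<Prod>D * t" by auto
    then have "t \<ge> 1" using n by (cases t) auto
    moreover have "t = n div \<Prod>D" using t pos by simp
    then have "t \<le> M div \<Prod>D" using n by (auto intro: div_le_mono)
    ultimately show "n \<in> (*) (\<Prod>D) ` {1..M div \<Prod>D}" using t by auto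
  qed
  then have "card {n \<in> {1..M}. \<forall>p\<in>D. p dvd n} \<le> card ((*) (\<Prod>D) ` {1..M div \<Prod>D})"
    by (intro card_mono) auto
  also have "\<dots> \<le> M div \<Prod>D" using card_image_le[of "{1..M div \<Prod>D}" "(*) (\<Prod>D)"] by simp
  finally have "real (card {n \<in> {1..M}. \<forall>p\<in>D. p dvd n}) \<le> real (M div \<Prod>D)" by (rule of_nat_mono)
  also have "\<dots> \<le> M / real (\<Prod>D)" by (rule of_nat_div_le_of_nat)
  finally show ?thesis .
qed

lemma sum_inverse_squares_le: "(\<Sum>m\<in>{2..Suc t}. 1 / (real m)\<^sup>2) \<le> 1 - 1 / real (Suc t)"
proof (induction t)
  case (Suc t)
  have "1 / (real (Suc (Suc t)))\<^sup>2 \<le> 1 / (real (Suc t) * real (Suc (Suc t)))"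
    unfolding power2_eq_square by (intro divide_left_mono mult_right_mono) auto
  also have "\<dots> = 1 / real (Suc t) - 1 / real (Suc (Suc t))" by (simp add: divide_simps)
  finally have "1 / (real (Suc (Suc t)))\<^sup>2 \<le> 1 / real (Suc t) - 1 / real (Suc (Suc t))" .
  then show ?case using Suc by simp
qed simp

text \<open>The squared factor is at most the product of \<open>1 + 6 / p\<close> over the sifting
  primes dividing \<open>n\<close>. After expanding and exchanging the sums, the density of
  multiples supplies a second \<open>1 / p\<close>, and the sum of \<open>6 / p\<^sup>2\<close> is
  at most 6.\<close>

lemma sum_local_factor_squared_le:
  "(\<Sum>n\<in>{1..M}. (local_factor J n)\<^sup>2) \<le> M * exp 6"
proof -
  let ?Q = "sifting_primes J"
  have Q: "prime p" "real p \<ge> 3" if "p \<in> ?Q" for p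
    using that by (auto simp: sifting_primes_def)
  have "(\<Sum>n\<in>{1..M}. (local_factor J n)\<^sup>2) \<le> (\<Sum>n\<in>{1..M}. \<Prod>p\<in>?Q. 1 + 6 / p * of_bool (p dvd n))"
    unfolding local_factor_def prod_power_distrib
  proof (intro sum_mono prod_mono conjI)
    fix n p assume "p \<in> ?Q"
    then have p: "real p \<ge> 3" by (rule Q)
    define x where "x = 1 / real p"
    have x: "0 < x" "x \<le> 1 / 3" using p by (auto simp: x_def field_simps)
    \<comment> \<open>This polynomial is \<open>(1 + 6 * x) * (1 - x)\<^sup>2 - 1\<close>.\<close>
    have "0 \<le> x * ((1 - 2 * x) * (4 - 3 * x))" using x by (intro mult_nonneg_nonneg) auto
    then have "1 \<le> (1 + 6 * x) * (1 - x)\<^sup>2" by (simp add: power2_eq_square algebra_simps)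
    then have "(1 / (1 - x))\<^sup>2 \<le> 1 + 6 * x" using x by (simp add: power_divide divide_le_eq)
    then show "(if p dvd n then 1 / (1 - 1 / real p) else 1)\<^sup>2 \<le> 1 + 6 / p * of_bool (p dvd n)"
      by (simp add: x_def)
  qed simp
  also have "\<dots> = (\<Sum>n\<in>{1..M}. \<Sum>D\<in>Pow ?Q. \<Prod>p\<in>D. 6 / p * of_bool (p dvd n))"
    by (simp only: expansion_all_subsets finite_sifting_primes)
  also have "\<dots> = (\<Sum>D\<in>Pow ?Q. \<Sum>n\<in>{1..M}. \<Prod>p\<in>D. 6 / p * of_bool (p dvd n))" by (rule sum.swap)
  also have "\<dots> \<le> (\<Sum>D\<in>Pow ?Q. M * (\<Prod>p\<in>D. 6 / (real p)\<^sup>2))"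
  proof (rule sum_mono)
    fix D assume "D \<in> Pow ?Q"
    then have D: "finite D" "\<And>p. p \<in> D \<Longrightarrow> prime p"
      using finite_subset[OF _ finite_sifting_primes] Q(1) by auto
    have "(\<Sum>n\<in>{1..M}. \<Prod>p\<in>D. 6 / p * of_bool (p dvd n)) =
        (\<Prod>p\<in>D. 6 / real p) * (\<Sum>n\<in>{1..M}. of_bool (\<forall>p\<in>D. p dvd n))"
      by (simp only: prod.distrib prod_of_bool[OF D(1)] sum_distrib_left)
    also have "(\<Sum>n\<in>{1..M}. of_bool (\<forall>p\<in>D. p dvd n)) = real (card {n \<in> {1..M}. \<forall>p\<in>D. p dvd n})"
      by (simp add: Int_def)
    also have "(\<Prod>p\<in>D. 6 / real p) * \<dots> \<le> (\<Prod>p\<in>D. 6 / real p) * (M / real (\<Prod>D))"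
      by (intro mult_left_mono card_common_multiples_le D prod_nonneg) auto
    also have "\<dots> = M * (\<Prod>p\<in>D. 6 / (real p)\<^sup>2)"
      by (simp add: prod_dividef power2_eq_square prod.distrib)
    finally show "(\<Sum>n\<in>{1..M}. \<Prod>p\<in>D. 6 / p * of_bool (p dvd n)) \<le> M * (\<Prod>p\<in>D. 6 / (real p)\<^sup>2)" .
  qed
  also have "\<dots> = M * (\<Prod>p\<in>?Q. 1 + 6 / (real p)\<^sup>2)"
    by (simp add: expansion_all_subsets sum_distrib_left)
  also have "\<dots> \<le> M * exp 6"
  proof (rule mult_left_mono)
    have "(\<Prod>p\<in>?Q. 1 + 6 / (real p)\<^sup>2) \<le> (\<Prod>p\<in>?Q. exp (6 * (1 / (real p)\<^sup>2)))"
      by (intro prod_mono conjI) (auto intro: add_nonneg_nonneg order_trans[OF exp_ge_add_one_self])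
    also have "\<dots> = exp (6 * (\<Sum>p\<in>?Q. 1 / (real p)\<^sup>2))" by (simp add: exp_sum sum_distrib_left)
    also have "\<dots> \<le> exp 6"
    proof -
      have "(\<Sum>p\<in>?Q. 1 / (real p)\<^sup>2) \<le> (\<Sum>p\<in>{2..Suc (2 ^ (2 ^ J))}. 1 / (real p)\<^sup>2)"
        by (rule sum_mono2) (auto simp: sifting_primes_def)
      also have "\<dots> \<le> 1 - 1 / real (Suc (2 ^ (2 ^ J)))" by (rule sum_inverse_squares_le)
      also have "\<dots> \<le> 1" by simp
      finally show ?thesis by simp
    qed
    finally show "(\<Prod>p\<in>?Q. 1 + 6 / (real p)\<^sup>2) \<le> exp 6" .
  qed simp
  finally show ?thesis .
qed

section \<open>Counting representations by two odd primes\<close>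

definition odd_primes_le :: "nat \<Rightarrow> nat set" where
  "odd_primes_le N = {p. prime p \<and> odd p \<and> p \<le> N}"

definition representations :: "nat \<Rightarrow> nat \<Rightarrow> nat" where
  "representations N n = card {p \<in> odd_primes_le N. p \<le> n \<and> n - p \<in> odd_primes_le N}"

lemma finite_odd_primes_le [simp]: "finite (odd_primes_le N)"
  unfolding odd_primes_le_def by (rule finite_subset[OF _ finite_primes_le]) auto

text \<open>If the primes \<open>m\<close> and \<open>n - m\<close> both exceed
  \<open>2 ^ (2 ^ J)\<close>, no sifting prime divides either, so \<open>m\<close> survives the
  sieve. The exceptions number at most \<open>2 * 2 ^ (2 ^ J) + 1\<close>; one more unit covers
  \<open>m = N\<close>, as the sieve counts \<open>m < N\<close>.\<close>

lemma representations_le_sieve: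
  "representations N n \<le>
     2 * 2 ^ (2 ^ J) + 2 + card {m. m < N \<and> (\<forall>p\<in>sifting_primes J. m mod p \<notin> forbidden n p)}"
proof -
  let ?z = "2 ^ (2 ^ J) :: nat"
  let ?S = "{m. m < N \<and> (\<forall>p\<in>sifting_primes J. m mod p \<notin> forbidden n p)}"
  let ?R = "{p \<in> odd_primes_le N. p \<le> n \<and> n - p \<in> odd_primes_le N}"
  have "?R \<subseteq> {1..?z} \<union> {n - ?z..n} \<union> insert N ?S"
  proof
    fix m assume m: "m \<in> ?R"
    then have pr: "prime m" "prime (n - m)" "m \<le> n" "m \<le> N" by (auto simp: odd_primes_le_def)
    show "m \<in> {1..?z} \<union> {n - ?z..n} \<union> insert N ?S"
    proof (cases "?z < m \<and> ?z < n - m")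
      case True
      have "m mod p \<notin> forbidden n p" if "p \<in> sifting_primes J" for p
      proof -
        have p: "prime p" "p \<le> ?z" using that by (auto simp: sifting_primes_def)
        have "\<not> p dvd m" "\<not> p dvd n - m" using p pr True by (auto simp: primes_dvd_imp_eq dest: primes_dvd_imp_eq)
        moreover have "p dvd n - m" if "m mod p = n mod p"
          using that pr(3) by (metis mod_eq_dvd_iff_nat)
        ultimately show ?thesis by (auto simp: forbidden_def dvd_eq_mod_eq_0)
      qed
      then show ?thesis using pr by auto
    next
      case False
      then show ?thesis using pr prime_ge_1_nat[of m] by auto
    qed
  qed
  then have "card ?R \<le> card ({1..?z} \<union> {n - ?z..n} \<union> insert N ?S)" by (intro card_mono) auto
  also have "\<dots> \<le> card {1..?z} + card {n - ?z..n} + card (insert N ?S)"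
    by (meson add_le_mono1 card_Un_le order_trans)
  also have "\<dots> \<le> ?z + (?z + 1) + (1 + card ?S)"
    by (intro add_mono) (auto simp: card_insert_if)
  finally show ?thesis by (simp add: representations_def)
qed

text \<open>The assumption keeps all secondary terms below \<open>2 ^ (16 * 2 ^ J + 1)\<close>,
  hence below \<open>2 ^ k / 4 ^ J\<close>; since \<open>local_factor\<close> is at least 1, they
  are absorbed by the \<open>+ 1\<close> in the constant.\<close>

lemma representations_le:
  assumes "32 * 2 ^ J \<le> k"
  shows "representations (2 ^ k) n \<le> (16 * exp (exp 20) + 1) * (2 ^ k / 4 ^ J) * local_factor J n"
proof -
  define W :: nat where "W = 2 ^ J"
  have W: "W \<ge> 1" "32 * W \<le> k" using assms by (auto simp: W_def)
  let ?F = "local_factor J n" and ?S = "card {m. m < 2 ^ k \<and> (\<forall>p\<in>sifting_primes J. m mod p \<notin> forbidden n p)}"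
  have "real (2 * 2 ^ W + 2) + 2 ^ (16 * W) \<le> 2 ^ k / 4 ^ J"
  proof -
    have "(2::real) ^ 1 \<le> 2 ^ W" using W by (intro power_increasing) auto
    then have "real (2 * 2 ^ W + 2) \<le> 2 ^ 2 * 2 ^ W" by simp
    also have "\<dots> = 2 ^ (2 + W)" by (simp only: power_add)
    also have "\<dots> \<le> 2 ^ (16 * W)" using W by (intro power_increasing) auto
    finally have "real (2 * 2 ^ W + 2) + 2 ^ (16 * W) \<le> 2 ^ (16 * W + 1)" by simp
    also have "\<dots> \<le> 2 ^ k / 4 ^ J"
    proof -
      have "J \<le> W" unfolding W_def by (rule less_imp_le[OF less_exp])
      have "(2::real) ^ (16 * W + 1) * 4 ^ J = 2 ^ (16 * W + 1 + 2 * J)"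
        by (simp add: power_add power_mult)
      also have "\<dots> \<le> 2 ^ k" using W \<open>J \<le> W\<close> by (intro power_increasing) auto
      finally show ?thesis by (simp only: pos_le_divide_eq zero_less_power zero_less_numeral)
    qed
    finally show ?thesis .
  qed
  also have "\<dots> \<le> 2 ^ k / 4 ^ J * ?F" using mult_left_mono[OF local_factor_ge_1, of "2 ^ k / 4 ^ J" J n] by simp
  finally have small: "real (2 * 2 ^ W + 2) + 2 ^ (16 * W) \<le> 2 ^ k / 4 ^ J * ?F" .
  have "real (representations (2 ^ k) n) \<le> real (2 * 2 ^ W + 2 + ?S)"
    unfolding W_def by (intro of_nat_mono representations_le_sieve)
  also have "\<dots> = real (2 * 2 ^ W + 2) + real ?S" by simp
  also have "real ?S \<le> real (2 ^ k) * (16 * exp (exp 20) / 4 ^ J * ?F) + 2 ^ (16 * W)"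
    unfolding W_def by (rule sieve_upper_bound)
  finally have "real (representations (2 ^ k) n) \<le>
      real (2 ^ k) * (16 * exp (exp 20) / 4 ^ J * ?F) + 2 ^ k / 4 ^ J * ?F" using small by linarith
  then show ?thesis by (simp add: algebra_simps)
qed

text \<open>Discarding the prime 2 and the \<open>+ 1\<close> of \<open>prime_count_lower\<close>
  costs \<open>k + 1\<close>, at most half of \<open>2 ^ k\<close>.\<close>

lemma card_odd_primes_lower:
  assumes "k \<ge> 4"
  shows "2 ^ k / (2 * k) \<le> real (card (odd_primes_le (2 ^ k)))"
proof -
  let ?P = "{p::nat. prime p \<and> p \<le> 2 ^ k}"
  have "?P \<subseteq> insert 2 (odd_primes_le (2 ^ k))"
    by (auto simp: odd_primes_le_def dest: primes_dvd_imp_eq[OF two_is_prime_nat])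
  then have "card ?P \<le> card (insert 2 (odd_primes_le (2 ^ k)))" by (intro card_mono) auto
  also have "\<dots> \<le> card (odd_primes_le (2 ^ k)) + 1" by (simp add: card_insert_if)
  finally have "k * card ?P \<le> k * (card (odd_primes_le (2 ^ k)) + 1)" by (rule mult_le_mono2)
  then have "2 ^ k \<le> k * (card (odd_primes_le (2 ^ k)) + 1) + 1"
    using prime_count_lower[of k] assms by linarith
  then have "real (2 ^ k) \<le> real (k * (card (odd_primes_le (2 ^ k)) + 1) + 1)" by (rule of_nat_mono)
  moreover have "2 * (k + 1) \<le> (2::nat) ^ k"
    using assms
  proof (induction k rule: dec_induct)
    case (step k)
    then show ?case by simp
  qed simp
  then have "real (2 * (k + 1)) \<le> real (2 ^ k)" by (rule of_nat_mono)
  ultimately show ?thesis using assms by (simp add: field_simps)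
qed

definition odd_prime_pair_sums :: "nat set" where
  "odd_prime_pair_sums = {p + q | p q. prime p \<and> odd p \<and> prime q \<and> odd q}"

lemma card_pairs_eq_sum_representations:
  "(card (odd_primes_le N))\<^sup>2 = (\<Sum>n\<in>odd_prime_pair_sums \<inter> {1..2 * N}. representations N n)"
proof -
  let ?P = "odd_primes_le N" and ?A = "odd_prime_pair_sums \<inter> {1..2 * N}"
  have "(card ?P)\<^sup>2 = card (?P \<times> ?P)" by (simp add: card_cartesian_product power2_eq_square)
  also have "\<dots> = (\<Sum>n\<in>?A. card {x \<in> ?P \<times> ?P. fst x + snd x = n})"
  proof -
    have "(\<Sum>n\<in>?A. \<Sum>x | x \<in> ?P \<times> ?P \<and> fst x + snd x = n. 1) = (\<Sum>x\<in>?P \<times> ?P. 1 :: nat)"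
    proof (rule sum.group)
      show "(\<lambda>x. fst x + snd x) ` (?P \<times> ?P) \<subseteq> ?A"
      proof clarify
        fix p q assume "p \<in> ?P" "q \<in> ?P"
        then have pq: "prime p" "odd p" "p \<le> N" "prime q" "odd q" "q \<le> N" by (auto simp: odd_primes_le_def)
        then have "p + q \<in> odd_prime_pair_sums" unfolding odd_prime_pair_sums_def by blast
        then show "fst (p, q) + snd (p, q) \<in> ?A" using pq prime_ge_1_nat[of p] by simp
      qed
    qed auto
    then show ?thesis unfolding card_eq_sum by (rule sym)
  qed
  also have "\<dots> = (\<Sum>n\<in>?A. representations N n)"
  proof (rule sum.cong[OF refl])
    fix n
    have "{x \<in> ?P \<times> ?P. fst x + snd x = n} = (\<lambda>p. (p, n - p)) ` {p \<in> ?P. p \<le> n \<and> n - p \<in> ?P}"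
      by (auto simp: image_iff)
    then show "card {x \<in> ?P \<times> ?P. fst x + snd x = n} = representations N n"
      by (simp add: representations_def card_image inj_on_def)
  qed
  finally show ?thesis .
qed

text \<open>With \<open>N = 2 ^ k\<close> and \<open>W = 2 ^ J\<close> comparable to
  \<open>k\<close>, the squared first moment is at least of order \<open>N ^ 4 / W ^ 4\<close> and
  the second moment at most of order \<open>N ^ 3 / W ^ 4\<close>. The powers of \<open>W\<close>
  cancel in Cauchy-Schwarz, leaving order \<open>N\<close> sums.\<close>

lemma counting_pair_sums_dyadic:
  obtains c :: real where "c > 0" "\<And>k. k \<ge> 32 \<Longrightarrow> c * 2 ^ Suc k \<le> counting odd_prime_pair_sums (2 ^ Suc k)"
proof -
  define K :: real where "K = 16 * exp (exp 20) + 1"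
  have K: "K > 0" unfolding K_def by (intro add_pos_pos) auto
  define c :: real where "c = 1 / (4 * 128 ^ 4 * K\<^sup>2 * exp 6)"
  show thesis
  proof (rule that)
    show "c > 0" using K by (simp add: c_def)
    fix k :: nat assume k: "k \<ge> 32"
    \<comment> \<open>\<open>2 ^ J\<close> is the largest power of 2 up to \<open>k div 32\<close>;
      this is where \<open>k \<ge> 32\<close> enters.\<close>
    obtain J where J: "32 * 2 ^ J \<le> k" "k < 64 * 2 ^ J"
    proof -
      have "1 \<le> k div 32" using div_le_mono[OF k, of 32] by simp
      then obtain J where "2 ^ J \<le> k div 32" "k div 32 < 2 ^ (J + 1)"
        using ex_power_ivl1[of 2 "k div 32"] by auto
      then show thesis by (intro that[of J]) auto
    qed
    define W :: real where "W = 2 ^ J"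
    define N :: real where "N = 2 ^ k"
    have W: "W > 0" and N: "N > 0" by (auto simp: W_def N_def)
    let ?A = "odd_prime_pair_sums \<inter> {1..2 * 2 ^ k}" and ?P = "odd_primes_le (2 ^ k)"
    let ?r = "\<lambda>n. real (representations (2 ^ k) n)"
    have W2: "4 ^ J = W\<^sup>2" by (simp add: W_def power2_eq_square flip: power_mult_distrib)
    have "real (card ?P) \<ge> N / (2 * k)" using card_odd_primes_lower[of k] k by (simp add: N_def)
    moreover have "N / (2 * k) \<ge> N / (128 * W)"
    proof (rule divide_left_mono)
      have "real k \<le> real (64 * 2 ^ J)" using J by (intro of_nat_mono) auto
      then show "real (2 * k) \<le> 128 * W" by (simp add: W_def)
    qed (use N W k in auto)
    ultimately have P: "N / (128 * W) \<le> card ?P" by linarith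
    have "(N / (128 * W)) ^ 4 \<le> real (card ?P) ^ 4" using P N W by (intro power_mono) auto
    also have "\<dots> = ((real (card ?P))\<^sup>2)\<^sup>2" by (simp flip: power_mult)
    also have "(real (card ?P))\<^sup>2 = (\<Sum>n\<in>?A. ?r n * 1)"
      using arg_cong[OF card_pairs_eq_sum_representations[of "2 ^ k"], of real] by simp
    also have "\<dots>\<^sup>2 \<le> (\<Sum>n\<in>?A. (?r n)\<^sup>2) * (\<Sum>n\<in>?A. 1\<^sup>2)" by (rule Cauchy_Schwarz_ineq_sum)
    also have "\<dots> = (\<Sum>n\<in>?A. (?r n)\<^sup>2) * card ?A" by simp
    also have "\<dots> \<le> (K\<^sup>2 * (N / W\<^sup>2)\<^sup>2 * (2 * N * exp 6)) * card ?A"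
    proof (rule mult_right_mono)
      have "(\<Sum>n\<in>?A. (?r n)\<^sup>2) \<le> (\<Sum>n\<in>?A. (K * (N / W\<^sup>2) * local_factor J n)\<^sup>2)"
        using representations_le[OF J(1)] by (intro sum_mono power_mono) (auto simp: K_def N_def W2)
      also have "\<dots> \<le> (\<Sum>n\<in>{1..2 * 2 ^ k}. (K * (N / W\<^sup>2) * local_factor J n)\<^sup>2)"
        by (rule sum_mono2) auto
      also have "\<dots> = K\<^sup>2 * (N / W\<^sup>2)\<^sup>2 * (\<Sum>n\<in>{1..2 * 2 ^ k}. (local_factor J n)\<^sup>2)"
        by (simp only: power_mult_distrib sum_distrib_left)
      also have "\<dots> \<le> K\<^sup>2 * (N / W\<^sup>2)\<^sup>2 * (2 * N * exp 6)"
        using sum_local_factor_squared_le[of J "2 * 2 ^ k"] by (intro mult_left_mono) (auto simp: N_def)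
      finally show "(\<Sum>n\<in>?A. (?r n)\<^sup>2) \<le> K\<^sup>2 * (N / W\<^sup>2)\<^sup>2 * (2 * N * exp 6)" .
    qed simp
    finally have "(N / (128 * W)) ^ 4 \<le> K\<^sup>2 * (N / W\<^sup>2)\<^sup>2 * (2 * N * exp 6) * card ?A" .
    then have "N ^ 4 / (128 ^ 4 * W ^ 4) \<le> (2 * K\<^sup>2 * exp 6 * card ?A) * N ^ 3 / W ^ 4"
      by (simp add: power_divide power_mult_distrib power2_eq_square power3_eq_cube power4_eq_xxxx mult_ac)
    then have "N ^ 3 * N / 128 ^ 4 \<le> N ^ 3 * (2 * K\<^sup>2 * exp 6 * card ?A)"
      using W by (simp add: field_simps power4_eq_xxxx power3_eq_cube)
    then have "N / 128 ^ 4 \<le> 2 * K\<^sup>2 * exp 6 * card ?A"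
      using N by (simp only: times_divide_eq_right[symmetric] mult_le_cancel_left_pos zero_less_power)
    moreover have "c * 2 ^ Suc k = N / 128 ^ 4 / (2 * K\<^sup>2 * exp 6)" by (simp add: c_def N_def)
    ultimately have "c * 2 ^ Suc k \<le> card ?A" using K by (simp add: divide_le_eq mult_ac)
    then show "c * 2 ^ Suc k \<le> counting odd_prime_pair_sums (2 ^ Suc k)" by (simp add: counting_def)
  qed
qed

lemma schnirelmann_density_pair_sums:
  obtains \<delta> :: real where "\<delta> > 0" "\<And>n. \<delta> * n \<le> counting (insert 1 odd_prime_pair_sums) n"
proof -
  obtain c :: real where c: "c > 0" "\<And>k. k \<ge> 32 \<Longrightarrow> c * 2 ^ Suc k \<le> counting odd_prime_pair_sums (2 ^ Suc k)"
    using counting_pair_sums_dyadic by blast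
  let ?A = "insert 1 odd_prime_pair_sums"
  \<comment> \<open>For \<open>n \<ge> 2 ^ 33\<close> the largest power of 2 up to \<open>n\<close>
    exceeds \<open>n / 2\<close>, which halves \<open>c\<close>; for smaller positive
    \<open>n\<close> the element 1 alone suffices.\<close>
  define \<delta> where "\<delta> = min (c / 2) (1 / 2 ^ 33)"
  have mono: "counting ?A m \<le> counting ?A n" if "m \<le> n" for m n
    unfolding counting_def using that by (intro card_mono) auto
  have "\<delta> * n \<le> counting ?A n" for n
  proof -
    consider "n = 0" | "1 \<le> n" "n < 2 ^ 33" | "2 ^ 33 \<le> n" by linarith
    then show ?thesis
    proof cases
      case 2
      have "\<delta> * n \<le> 1 / 2 ^ 33 * n" by (intro mult_right_mono) (auto simp: \<delta>_def)
      also have "\<dots> \<le> 1" using 2 by simp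
      also have "\<dots> \<le> real (counting ?A 1)" by (simp add: counting_def)
      also have "\<dots> \<le> counting ?A n" using mono[OF 2(1)] by simp
      finally show ?thesis .
    next
      case 3
      then obtain j where j: "2 ^ j \<le> n" "n < 2 ^ (j + 1)" using ex_power_ivl1[of 2 n] by auto
      then have "(2::nat) ^ 33 < 2 ^ (j + 1)" using 3 by linarith
      then have "33 < j + 1" by (rule power_less_imp_less_exp[rotated]) simp
      then obtain k where k: "j = Suc k" "k \<ge> 32" by (cases j) auto
      have "\<delta> * n \<le> c / 2 * n" by (intro mult_right_mono) (auto simp: \<delta>_def)
      also have "\<dots> \<le> c / 2 * real (2 ^ (j + 1))" using j c by (intro mult_left_mono of_nat_mono) auto
      also have "\<dots> = c * 2 ^ Suc k" by (simp add: k)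
      also have "\<dots> \<le> counting odd_prime_pair_sums (2 ^ Suc k)" using c(2)[OF k(2)] .
      also have "\<dots> \<le> counting ?A (2 ^ Suc k)" by (intro of_nat_mono counting_mono) auto
      also have "\<dots> \<le> counting ?A n" using j by (intro of_nat_mono mono) (auto simp: k)
      finally show ?thesis .
    qed simp
  qed
  moreover have "\<delta> > 0" using c by (simp add: \<delta>_def)
  ultimately show thesis using that by blast
qed

section \<open>Sums of boundedly many odd primes\<close>

text \<open>Start from 5, 3 + 3 and 7 and add threes. The crude size bound is enough because
  \<open>m\<close> will be bounded.\<close>

lemma sum_of_small_odd_primes:
  assumes "m \<ge> 5"
  obtains M :: "nat multiset" where "\<forall>p\<in>#M. prime p \<and> odd p" "size M \<le> m" "sum_mset M = m"
proof -
  have "\<exists>M :: nat multiset. (\<forall>p\<in>#M. prime p \<and> odd p) \<and> size M \<le> m \<and> sum_mset M = m"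
    using assms
  proof (induction m rule: less_induct)
    case (less m)
    consider "m = 5" | "m = 6" | "m = 7" | "m \<ge> 8" using less.prems by linarith
    then show ?case
    proof cases
      case 1 then show ?thesis by (intro exI[of _ "{#5#}"]) simp
    next
      case 2 then show ?thesis by (intro exI[of _ "{#3, 3#}"]) simp
    next
      case 3 then show ?thesis by (intro exI[of _ "{#7#}"]) simp
    next
      case 4
      then have "m - 3 < m" "5 \<le> m - 3" by auto
      then obtain M :: "nat multiset" where "\<forall>p\<in>#M. prime p \<and> odd p" "size M \<le> m - 3" "sum_mset M = m - 3"
        using less.IH[of "m - 3"] by blast
      then show ?thesis using 4 by (intro exI[of _ "add_mset 3 M"]) auto
    qed
  qed
  then show thesis using that by blast
qed

text \<open>Pair sums unfold into two odd primes each; the ones are not primes and are collected in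
  \<open>l\<close> for later treatment.\<close>

lemma multiset_of_ones_and_pair_sums:
  assumes "set_mset M \<subseteq> insert 1 odd_prime_pair_sums"
  obtains l and Q :: "nat multiset" where "l \<le> size M" "\<forall>p\<in>#Q. prime p \<and> odd p"
    "size Q \<le> 2 * size M" "sum_mset M = l + sum_mset Q"
proof -
  have "\<exists>l (Q :: nat multiset). l \<le> size M \<and> (\<forall>p\<in>#Q. prime p \<and> odd p) \<and>
      size Q \<le> 2 * size M \<and> sum_mset M = l + sum_mset Q"
    using assms
  proof (induction M)
    case (add a M)
    then obtain l and Q :: "nat multiset" where IH: "l \<le> size M" "\<forall>p\<in>#Q. prime p \<and> odd p"
      "size Q \<le> 2 * size M" "sum_mset M = l + sum_mset Q" by auto
    consider "a = 1" | p q where "a = p + q" "prime p" "odd p" "prime q" "odd q"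
      using add.prems by (auto simp: odd_prime_pair_sums_def)
    then show ?case
    proof cases
      case 1
      then show ?thesis using IH by (intro exI[of _ "Suc l"] exI[of _ Q]) auto
    next
      case 2
      then show ?thesis using IH by (intro exI[of _ l] exI[of _ "Q + {#p, q#}"]) auto
    qed
  qed simp
  then show thesis using that by blast
qed

theorem theorem4:
  "\<exists>k::nat. k > 0 \<and> (\<forall>n::nat. n \<ge> 2 \<longrightarrow>
     (\<exists>M :: nat multiset. size M \<le> k \<and> (\<forall>p\<in>#M. prime p) \<and>
        (n \<notin> {2, 4} \<longrightarrow> (\<forall>p\<in>#M. odd p)) \<and> sum_mset M = n))"
proof -
  obtain \<delta> :: real where "\<delta> > 0" "\<And>n. \<delta> * n \<le> counting (insert 1 odd_prime_pair_sums) n"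
    using schnirelmann_density_pair_sums by blast
  then obtain h where h: "sums_le h (insert 1 odd_prime_pair_sums) = UNIV"
    using schnirelmann_basis by blast
  \<comment> \<open>The pair sums give at most \<open>2 * h\<close> primes, and \<open>6 + l\<close>
    with \<open>l \<le> h\<close> at most \<open>6 + h\<close> more.\<close>
  have "\<exists>M :: nat multiset. size M \<le> 3 * h + 6 \<and> (\<forall>p\<in>#M. prime p) \<and>
        (n \<notin> {2, 4} \<longrightarrow> (\<forall>p\<in>#M. odd p)) \<and> sum_mset M = n" if n: "n \<ge> 2" for n :: nat
  proof -
    consider "n = 2" | "n = 3" | "n = 4" | "n = 5" | "n \<ge> 6" using n by linarith
    then show ?thesis
    proof cases
      case 1 then show ?thesis by (intro exI[of _ "{#2#}"]) simp
    next
      case 2 then show ?thesis by (intro exI[of _ "{#3#}"]) simp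
    next
      case 3 then show ?thesis by (intro exI[of _ "{#2, 2#}"]) simp
    next
      case 4 then show ?thesis by (intro exI[of _ "{#5#}"]) simp
    next
      case 5
      \<comment> \<open>Holding back 6 makes \<open>6 + l\<close> a sum of odd primes even when
        \<open>l\<close> is small or zero.\<close>
      have "n - 6 \<in> sums_le h (insert 1 odd_prime_pair_sums)" using h by simp
      then obtain M where M: "set_mset M \<subseteq> insert 1 odd_prime_pair_sums" "size M \<le> h" "n - 6 = sum_mset M"
        unfolding sums_le_def by auto
      obtain l and Q :: "nat multiset" where Q: "l \<le> size M" "\<forall>p\<in>#Q. prime p \<and> odd p"
        "size Q \<le> 2 * size M" "sum_mset M = l + sum_mset Q"
        using multiset_of_ones_and_pair_sums[OF M(1)] by blast
      obtain Q' :: "nat multiset" where Q': "\<forall>p\<in>#Q'. prime p \<and> odd p" "size Q' \<le> 6 + l" "sum_mset Q' = 6 + l"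
        using sum_of_small_odd_primes[of "6 + l"] by auto
      show ?thesis
        using M Q Q' 5 by (intro exI[of _ "Q + Q'"]) auto
    qed
  qed
  then show ?thesis by (intro exI[of _ "3 * h + 6"]) simp
qed

end
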